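(* Let $h>0$, let $\phi$ be a G-convex external field in $(a,b)$ (possibly unbounded), and let $n\ge 1$ be an integer with $n\le\lceil (b-a)/h\rceil$ (no restriction on $n$ if $(a,b)$ is unbounded). Then there exists a unique critical distribution of $n$ charges under $\phi$ in $(a,b)$, and it is an equilibrium distribution. Moreover, this distribution $x_1<\dots<x_n$ can be obtained by the Iterating Energy Decreasing Method: for any initial data $a<x_1^{(0)}<\dots<x_n^{(0)}<b$ with $x_{j+1}^{(0)}>x_j^{(0)}+h$ for $j=1,\dots,n-1$, the iterates $x_j^{(\ell)}$ produced by the method satisfy $\lim_{\ell\to\infty}x_j^{(\ell)}=x_j$ for $j=1,\dots,n$.
   Context: Forces and potentials. The force that a unit charge at $x\in\mathbb{R}$ exerts on a unit charge at $y$ is $$F_x(y)=\frac{1}{2h}\log\frac{y-x+h}{y-x-h},\qquad y\in\mathbb{R}\setminus[x-h,x+h],$$ and the associated potential, an antiderivative of $-F_x$, is $$V_x(y)=\frac{x-y}{2h}\log\left(\frac{y-x+h}{y-x-h}\right)-\frac12\log\big((y-x+h)(y-x-h)\big).$$ External field. It is given by two relatively prime real polynomials $A,B$ with $1+B/A>0$ in $(a,b)$, through $$F_\phi(x)=-\phi'(x)=\frac{1}{2h}\log\left(1+\frac{B(x)}{A(x)}\right),\qquad x\in(a,b)$$ ($\phi$ extends to the finite endpoints of $(a,b)$). G-convex. $\phi$ is G-convex in $(a,b)$ if $1+B/A$ is positive and decreasing in $(a,b)$ and: if $a\in\mathbb{R}$ then $A(a)=0$, while if $a=-\infty$ then $\lim_{x\to-\infty}(1+B/A)(x)\in(1,+\infty]$;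 if $b\in\mathbb{R}$ then $(A+B)(b)=0$, while if $b=+\infty$ then $\lim_{x\to+\infty}(1+B/A)(x)\in[0,1)$. Critical distribution (of $n$ charges): points $a<x_1<\dots<x_n<b$ with $x_{j+1}>x_j+h$ for $j=1,\dots,n-1$ such that $\sum_{k\neq j}F_{x_k}(x_j)+F_\phi(x_j)=0$ for $j=1,\dots,n$. Energy: $\mathcal{E}_\phi(x_1,\dots,x_n)=\sum_{j,k=1,\,j\neq k}^n V_{x_k}(x_j)+2\sum_{j=1}^n\phi(x_j)$. Equilibrium distribution: points $a\le x_1<\dots<x_n\le b$ with $x_{j+1}>x_j+h$ for $j=1,\dots,n-1$ that minimize $\mathcal{E}_\phi$ among all distributions of $n$ points in $(a,b)$ with mutual distances greater than $h$. Iterating Energy Decreasing Method. Given $x_1^{(0)},\dots,x_n^{(0)}$ as in the claim, define successively, for $\ell=0,1,2,\dots$ and, for each $\ell$, for $j=1,\dots,n$ in this order, $x_j^{(\ell+1)}$ as the unique point $x$ of the interval $(x_{j-1}^{(\ell+1)}+h,\;x_{j+1}^{(\ell)}-h)\cap(a,b)$ with $$\sum_{k=1}^{j-1}F_{x_k^{(\ell+1)}}(x)+\sum_{k=j+1}^{n}F_{x_k^{(\ell)}}(x)+F_\phi(x)=0,$$ where for $j=1$ the left endpoint of the interval is $a$ and for $j=n$ the right endpoint is $b$. (For G-convex $\phi$ the left-hand side is strictly decreasing on this nonempty interval and changes sign there, so the method is well defined.) *)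

theory Defs
  imports "HOL-Analysis.Analysis" "HOL-Computational_Algebra.Polynomial"
begin

text \<open>
  Intervals \<open>(a, b)\<close> have extended real endpoints; \<open>einterval a b\<close> is the set of real points
  strictly between them. A distribution of \<open>n\<close> charges is a function \<open>x :: nat \<Rightarrow> real\<close> of which
  only the values \<open>x 1, \<dots>, x n\<close> matter.
\<close>

text \<open>\<open>charge_force h x y\<close> is \<open>F\<^sub>x(y)\<close>, meaningful for \<open>\<bar>y - x\<bar> > h\<close>; there the
  arguments of the logarithms below are positive, whatever the sign of \<open>y - x\<close>.\<close>

definition charge_force :: "real \<Rightarrow> real \<Rightarrow> real \<Rightarrow> real" where
  "charge_force h x y = 1 / (2 * h) * ln ((y - x + h) / (y - x - h))"

definition charge_potential :: "real \<Rightarrow> real \<Rightarrow> real \<Rightarrow> real" where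
  "charge_potential h x y =
     (x - y) / (2 * h) * ln ((y - x + h) / (y - x - h)) - 1 / 2 * ln ((y - x + h) * (y - x - h))"

definition field_force :: "(real \<Rightarrow> real) \<Rightarrow> real \<Rightarrow> real" where
  "field_force \<phi> x = - deriv \<phi> x"

text \<open>Division by zero yields zero in HOL, so that \<open>1 + B/A\<close> is defined on \<open>(a, b)\<close> has to be
  required explicitly. The continuity clause is the extension of \<open>\<phi>\<close> to the finite
  endpoints.\<close>

definition external_field ::
  "real \<Rightarrow> ereal \<Rightarrow> ereal \<Rightarrow> real poly \<Rightarrow> real poly \<Rightarrow> (real \<Rightarrow> real) \<Rightarrow> bool" where
  "external_field h a b A B \<phi> \<longleftrightarrow>
     coprime A B \<and>
     (\<forall>x\<in>einterval a b. poly A x \<noteq> 0 \<and> 1 + poly B x / poly A x > 0) \<and>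
     (\<forall>x\<in>einterval a b.
        (\<phi> has_real_derivative - (1 / (2 * h) * ln (1 + poly B x / poly A x))) (at x)) \<and>
     continuous_on {x. a \<le> ereal x \<and> ereal x \<le> b} \<phi>"

definition G_convex ::
  "real \<Rightarrow> ereal \<Rightarrow> ereal \<Rightarrow> real poly \<Rightarrow> real poly \<Rightarrow> (real \<Rightarrow> real) \<Rightarrow> bool" where
  "G_convex h a b A B \<phi> \<longleftrightarrow>
     external_field h a b A B \<phi> \<and>
     antimono_on (einterval a b) (\<lambda>x. 1 + poly B x / poly A x) \<and>
     (\<forall>a'. a = ereal a' \<longrightarrow> poly A a' = 0) \<and>
     (a = -\<infinity> \<longrightarrow>
        (\<exists>L::ereal. 1 < L \<and> ((\<lambda>x. ereal (1 + poly B x / poly A x)) \<longlongrightarrow> L) at_bot)) \<and>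
     (\<forall>b'. b = ereal b' \<longrightarrow> poly (A + B) b' = 0) \<and>
     (b = \<infinity> \<longrightarrow>
        (\<exists>L::real. 0 \<le> L \<and> L < 1 \<and> ((\<lambda>x. 1 + poly B x / poly A x) \<longlongrightarrow> L) at_top))"

definition separated :: "real \<Rightarrow> nat \<Rightarrow> (nat \<Rightarrow> real) \<Rightarrow> bool" where
  "separated h n x \<longleftrightarrow> strict_mono_on {1..n} x \<and> (\<forall>j\<in>{1..<n}. x (j + 1) > x j + h)"

definition admissible :: "real \<Rightarrow> ereal \<Rightarrow> ereal \<Rightarrow> nat \<Rightarrow> (nat \<Rightarrow> real) \<Rightarrow> bool" where
  "admissible h a b n x \<longleftrightarrow> (\<forall>j\<in>{1..n}. x j \<in> einterval a b) \<and> separated h n x"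

definition critical_distribution ::
  "real \<Rightarrow> ereal \<Rightarrow> ereal \<Rightarrow> (real \<Rightarrow> real) \<Rightarrow> nat \<Rightarrow> (nat \<Rightarrow> real) \<Rightarrow> bool" where
  "critical_distribution h a b \<phi> n x \<longleftrightarrow>
     admissible h a b n x \<and>
     (\<forall>j\<in>{1..n}. (\<Sum>k\<in>{1..n} - {j}. charge_force h (x k) (x j)) + field_force \<phi> (x j) = 0)"

definition energy :: "real \<Rightarrow> (real \<Rightarrow> real) \<Rightarrow> nat \<Rightarrow> (nat \<Rightarrow> real) \<Rightarrow> real" where
  "energy h \<phi> n x =
     (\<Sum>j\<in>{1..n}. \<Sum>k\<in>{1..n} - {j}. charge_potential h (x k) (x j)) + 2 * (\<Sum>j\<in>{1..n}. \<phi> (x j))"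

text \<open>The minimizer may touch finite endpoints, its competitors may not; the competitors need
  not be listed in increasing order.\<close>

definition equilibrium_distribution ::
  "real \<Rightarrow> ereal \<Rightarrow> ereal \<Rightarrow> (real \<Rightarrow> real) \<Rightarrow> nat \<Rightarrow> (nat \<Rightarrow> real) \<Rightarrow> bool" where
  "equilibrium_distribution h a b \<phi> n x \<longleftrightarrow>
     (\<forall>j\<in>{1..n}. a \<le> ereal (x j) \<and> ereal (x j) \<le> b) \<and> separated h n x \<and>
     (\<forall>y. (\<forall>j\<in>{1..n}. y j \<in> einterval a b) \<and>
          (\<forall>j\<in>{1..n}. \<forall>k\<in>{1..n}. j \<noteq> k \<longrightarrow> \<bar>y j - y k\<bar> > h)
        \<longrightarrow> energy h \<phi> n x \<le> energy h \<phi> n y)"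

text \<open>\<open>iedm_solution h a b \<phi> n X l j t\<close>: the point \<open>t\<close> lies in the interval and solves the equation
  that determine \<open>X (l + 1) j\<close>, where \<open>X l j\<close> stands for \<open>x\<^sub>j\<close> at stage \<open>l\<close>. The guards on \<open>j\<close>
  drop the missing neighbour at \<open>j = 1\<close> and \<open>j = n\<close>.\<close>

definition iedm_solution ::
  "real \<Rightarrow> ereal \<Rightarrow> ereal \<Rightarrow> (real \<Rightarrow> real) \<Rightarrow> nat \<Rightarrow> (nat \<Rightarrow> nat \<Rightarrow> real) \<Rightarrow> nat \<Rightarrow> nat \<Rightarrow> real \<Rightarrow> bool" where
  "iedm_solution h a b \<phi> n X l j t \<longleftrightarrow>
     t \<in> einterval a b \<and>
     (1 < j \<longrightarrow> X (l + 1) (j - 1) + h < t) \<and>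
     (j < n \<longrightarrow> t < X l (j + 1) - h) \<and>
     (\<Sum>k\<in>{1..<j}. charge_force h (X (l + 1) k) t) + (\<Sum>k\<in>{j<..n}. charge_force h (X l k) t)
       + field_force \<phi> t = 0"

definition iedm_iterates ::
  "real \<Rightarrow> ereal \<Rightarrow> ereal \<Rightarrow> (real \<Rightarrow> real) \<Rightarrow> nat \<Rightarrow> (nat \<Rightarrow> real) \<Rightarrow> (nat \<Rightarrow> nat \<Rightarrow> real) \<Rightarrow> bool" where
  "iedm_iterates h a b \<phi> n x0 X \<longleftrightarrow>
     (\<forall>j\<in>{1..n}. X 0 j = x0 j) \<and>
     (\<forall>l. \<forall>j\<in>{1..n}. iedm_solution h a b \<phi> n X l j (X (l + 1) j) \<and>
        (\<forall>t. iedm_solution h a b \<phi> n X l j t \<longrightarrow> t = X (l + 1) j))"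

end

theory Submission
  imports Defs
begin

text \<open>
  The force \<open>F\<^sub>x(y)\<close> is strictly decreasing in \<open>y - x\<close> on each side of \<open>[-h, h]\<close>, and the field
  force is strictly decreasing. So one pass of the method (a sweep) is order preserving, and,
  looking at the index where the difference is largest, a subsolution
  (all net forces \<open>\<ge> 0\<close>) lies to the left of any supersolution (all net forces \<open>\<le> 0\<close>); in particular
  a critical distribution is unique. Starting from a supersolution the iterates decrease and remain supersolutions; adding the net forces of all
  charges to the right of a gap cancels the internal forces and bounds the force across the gap,
  so the charges stay uniformly separated by more than \<open>h\<close> and the limit is critical. Every
  initial distribution lies between a subsolution and a supersolution, hence its iterates are
  squeezed to the critical distribution. The energy is convex on ordered distributions, so the
  critical distribution minimizes it.
\<close>

section \<open>The force between two charges\<close>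

text \<open>Two things could spoil the passage to the limit: charges may approach the distance
  \<open>h\<close>, where the pair force blows up, or run into an end of the interval. The force
  across a gap excludes the first, a barrier the second: a subsolution below a decreasing sequence,
  a supersolution above an increasing one. General iterates are not monotone, so both barriers have
  to be constructed beyond arbitrary initial data. There the end conditions of a G-convex field
  enter: at a finite end the field force is unbounded and beats a whole cascade of pair forces; at
  an infinite end it merely keeps a sign, but the charges can be spread until their interaction is
  negligible. A locale retains just these properties; it is stable under reflection. The polynomials
  return only at the end: coprimality yields the unboundedness, and strict monotonicity holds
  because a nonzero polynomial has finitely many roots. Convexity of the energy is available only
  for distributions in the same order, so competitors are sorted beforehand.\<close>

abbreviation pair_force :: "real \<Rightarrow> real \<Rightarrow> real" where
  "pair_force h \<equiv> charge_force h 0"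

lemma charge_force_diff: "charge_force h x y = pair_force h (y - x)"
  by (simp add: charge_force_def)

text \<open>The argument of the logarithm turns into its reciprocal. As \<open>ln_inverse\<close>
  carries no sign condition, oddness also covers \<open>\<bar>d\<bar> \<le> h\<close>, so double
  sums cancel with their diagonal included.\<close>

lemma pair_force_minus [simp]: "pair_force h (- d) = - pair_force h d"
proof -
  have "(- d + h) / (- d - h) = - (- d + h) / - (- d - h)"
    by (rule minus_divide_divide [symmetric])
  also have "\<dots> = inverse ((d + h) / (d - h))"
    by (simp add: add.commute)
  finally have "ln ((- d + h) / (- d - h)) = - ln ((d + h) / (d - h))"
    by (simp only: ln_inverse)
  then show ?thesis
    by (simp add: charge_force_def)
qed

lemma pair_force_0 [simp]: "pair_force h 0 = 0"
  using pair_force_minus [of h 0] by simp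

lemma pair_force_eq:
  assumes "h < d"
  shows "pair_force h d = 1 / (2 * h) * ln (1 + 2 * h / (d - h))"
proof -
  have "(d + h) / (d - h) = 1 + 2 * h / (d - h)"
    using assms by (simp add: field_simps)
  then show ?thesis
    by (simp add: charge_force_def)
qed

lemma pair_force_pos:
  assumes "0 < h" "h < d"
  shows "0 < pair_force h d"
  unfolding pair_force_eq [OF assms(2)] using assms by (intro mult_pos_pos ln_gt_zero) auto

lemma pair_force_neg:
  assumes "0 < h" "d < - h"
  shows "pair_force h d < 0"
  using pair_force_pos [of h "- d"] assms by simp

lemma pair_force_less:
  assumes "0 < h" "h < d" "d < e"
  shows "pair_force h e < pair_force h d"
proof -
  have "2 * h / (e - h) < 2 * h / (d - h)"
    using assms by (intro divide_strict_left_mono mult_pos_pos) auto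
  moreover have "0 < 2 * h / (e - h)"
    using assms by simp
  ultimately have "ln (1 + 2 * h / (e - h)) < ln (1 + 2 * h / (d - h))"
    by simp
  then show ?thesis
    using assms by (simp add: pair_force_eq divide_strict_right_mono)
qed

text \<open>As \<open>d \<le> e\<close>, either alternative puts both arguments on the same side of
  the band from \<open>- h\<close> to \<open>h\<close>. Across the band the force rises from
  negative to positive values.\<close>

lemma pair_force_antimono:
  assumes "0 < h" "h < d \<or> e < - h" "d \<le> e"
  shows "pair_force h e \<le> pair_force h d"
proof (cases "d = e")
  case False
  then show ?thesis
    using assms pair_force_less [of h d e] pair_force_less [of h "- e" "- d"] by fastforce
qed simp

lemma pair_force_unbounded:
  assumes "0 < h" "0 < \<epsilon>"
  obtains \<delta> where "0 < \<delta>" "\<delta> < \<epsilon>" "pair_force h (h + \<delta>) > K"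
proof -
  \<comment> \<open>By \<open>pair_force_eq\<close> it is enough that
    \<open>2 * h / \<delta>\<close> reaches \<open>M\<close>: then the logarithm exceeds
    \<open>2 * h * \<bar>K\<bar>\<close>.\<close>
  define M where "M = exp (2 * h * \<bar>K\<bar>)"
  define \<delta> where "\<delta> = min (\<epsilon> / 2) (2 * h / M)"
  have M: "M > 0" by (simp add: M_def)
  have \<delta>: "0 < \<delta>" "\<delta> < \<epsilon>" using assms M by (auto simp: \<delta>_def)
  have "M * \<delta> \<le> M * (2 * h / M)"
    using M by (intro mult_left_mono) (auto simp: \<delta>_def)
  then have "M \<le> 2 * h / \<delta>"
    using \<delta> M by (simp add: pos_le_divide_eq)
  then have "M < 1 + 2 * h / \<delta>" by simp
  then have less: "ln M < ln (1 + 2 * h / \<delta>)" using M by simp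
  have "K \<le> 1 / (2 * h) * ln M"
    using assms by (simp add: M_def)
  also have "\<dots> < 1 / (2 * h) * ln (1 + 2 * h / \<delta>)"
    using less assms by (intro mult_strict_left_mono) auto
  finally have "K < 1 / (2 * h) * ln (1 + 2 * h / \<delta>)" .
  then show ?thesis
    using that \<delta> by (simp add: pair_force_eq)
qed

lemma pair_force_vanishing:
  assumes "0 < h" "0 < \<epsilon>"
  obtains R where "h < R" "\<And>d. R \<le> d \<Longrightarrow> pair_force h d < \<epsilon>"
proof
  \<comment> \<open>\<open>ln (1 + s) \<le> s\<close> bounds the force by
    \<open>1 / (d - h)\<close>, so \<open>d - h > 1 / \<epsilon>\<close> suffices.\<close>
  define R where "R = h + 1 + 1 / \<epsilon>"
  show "h < R" using assms by (auto simp: R_def add_pos_pos)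
  show "pair_force h d < \<epsilon>" if "R \<le> d" for d
  proof -
    have d: "d - h > 1 / \<epsilon>" using that by (simp add: R_def)
    then have pos: "d - h > 0" using assms by (smt (verit) divide_pos_pos)
    have "ln (1 + 2 * h / (d - h)) \<le> 2 * h / (d - h)"
      using assms pos by (intro ln_add_one_self_le_self) simp
    then have "pair_force h d \<le> 1 / (d - h)"
      using assms pos by (simp add: pair_force_eq field_simps)
    also have "\<dots> < \<epsilon>"
      using d assms pos by (simp add: field_simps)
    finally show ?thesis .
  qed
qed

lemma continuous_on_charge_force:
  assumes "\<And>s. s \<in> S \<Longrightarrow> h < \<bar>s - x\<bar>" "0 < h"
  shows "continuous_on S (charge_force h x)"
proof -
  have "0 < (s - x + h) / (s - x - h)" if "s \<in> S" for s
    using assms(1) [OF that] assms(2) by (auto simp: zero_less_divide_iff abs_if split: if_splits)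
  then have "(s - x + h) / (s - x - h) \<noteq> 0" "s - x - h \<noteq> 0" if "s \<in> S" for s
    using that by fastforce+
  then show ?thesis
    unfolding charge_force_def by (intro continuous_intros) auto
qed

lemma tendsto_pair_force:
  assumes "(f \<longlongrightarrow> d) F" "h < \<bar>d\<bar>" "0 < h"
  shows "((\<lambda>l. pair_force h (f l)) \<longlongrightarrow> pair_force h d) F"
proof -
  have "continuous_on {s. h < \<bar>s\<bar>} (pair_force h)"
    using assms by (intro continuous_on_charge_force) auto
  moreover have "open {s. h < \<bar>s\<bar>}"
    by (intro open_Collect_less continuous_intros)
  ultimately have "isCont (pair_force h) d"
    using assms by (simp add: continuous_on_eq_continuous_at)
  then show ?thesis
    using assms(1) by (rule isCont_tendsto_compose)
qed

section \<open>Separation of all pairs and of neighbours\<close>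

lemma admissible_iff:
  assumes "0 \<le> h"
  shows "admissible h a b n x \<longleftrightarrow>
    (\<forall>j\<in>{1..n}. x j \<in> einterval a b) \<and> (\<forall>i j. 1 \<le> i \<longrightarrow> i < j \<longrightarrow> j \<le> n \<longrightarrow> x i + h < x j)"
proof
  assume adm: "admissible h a b n x"
  have "x i + h < x j" if "1 \<le> i" "i < j" "j \<le> n" for i j
  proof -
    have "x i + h < x (Suc i)"
      using adm that by (auto simp: admissible_def separated_def)
    moreover have "x (Suc i) \<le> x j"
    proof (cases "Suc i = j")
      case False
      then show ?thesis
        using adm that strict_mono_onD [of "{1..n}" x "Suc i" j]
        by (simp add: admissible_def separated_def)
    qed simp
    ultimately show ?thesis by simp
  qed
  then show "(\<forall>j\<in>{1..n}. x j \<in> einterval a b) \<and> (\<forall>i j. 1 \<le> i \<longrightarrow> i < j \<longrightarrow> j \<le> n \<longrightarrow> x i + h < x j)"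
    using adm by (auto simp: admissible_def)
next
  assume R: "(\<forall>j\<in>{1..n}. x j \<in> einterval a b) \<and> (\<forall>i j. 1 \<le> i \<longrightarrow> i < j \<longrightarrow> j \<le> n \<longrightarrow> x i + h < x j)"
  have "strict_mono_on {1..n} x"
  proof (rule strict_mono_onI)
    fix r s assume "r \<in> {1..n}" "s \<in> {1..n}" "r < s"
    then have "x r + h < x s" using R by auto
    then show "x r < x s" using assms by simp
  qed
  then show "admissible h a b n x"
    using R by (auto simp: admissible_def separated_def)
qed

lemma admissible_if_neighbours:
  assumes "0 \<le> h" "\<And>j. j \<in> {1..n} \<Longrightarrow> x j \<in> einterval a b"
    and step: "\<And>j. 1 \<le> j \<Longrightarrow> j < n \<Longrightarrow> x j + h < x (Suc j)"
  shows "admissible h a b n x"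
proof -
  have "x i + h < x j" if "i < j" "1 \<le> i" "j \<le> n" for i j
    using that
  proof (induction rule: less_Suc_induct)
    case (1 i)
    then show ?case using step by simp
  next
    case (2 i j k)
    then have "x i + h < x j" "x j + h < x k" by auto
    then show ?case using assms(1) by simp
  qed
  then show ?thesis
    using assms by (auto simp: admissible_iff)
qed

lemma einterval_uminus: "x \<in> einterval (- b) (- a) \<longleftrightarrow> - x \<in> einterval a b"
  by (cases a; cases b) (auto simp: einterval_iff)

lemma einterval_between:
  "\<lbrakk>x \<in> einterval a b; z \<in> einterval a b; x \<le> y; y \<le> z\<rbrakk> \<Longrightarrow> y \<in> einterval a b"
  by (cases a; cases b) (auto simp: einterval_iff)

section \<open>Comparison of sub- and supersolutions\<close>

text \<open>Here \<open>g\<close> is the field force. At a finite end it has to beat pair forces of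
  any size, hence the unboundedness; at an infinite end its sign is enough, because pair forces
  vanish at large distances.\<close>

locale charge_field =
  fixes h :: real and a b :: ereal and g :: "real \<Rightarrow> real" and n :: nat
  assumes h_pos: "0 < h"
    and g_less: "\<lbrakk>x \<in> einterval a b; y \<in> einterval a b; x < y\<rbrakk> \<Longrightarrow> g y < g x"
    and g_cont: "continuous_on (einterval a b) g"
    and left_pos: "\<exists>x\<in>einterval a b. 0 < g x"
    and left_unbounded: "a \<noteq> - \<infinity> \<Longrightarrow> \<exists>x\<in>einterval a b. K < g x"
    and right_neg: "\<exists>x\<in>einterval a b. g x < 0"
    and right_unbounded: "b \<noteq> \<infinity> \<Longrightarrow> \<exists>x\<in>einterval a b. g x < K"
begin

abbreviation I :: "real set" where
  "I \<equiv> einterval a b"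

abbreviation adm :: "(nat \<Rightarrow> real) \<Rightarrow> bool" where
  "adm \<equiv> admissible h a b n"

abbreviation others :: "nat \<Rightarrow> nat set" where
  "others j \<equiv> {1..n} - {j}"

definition net_force :: "nat set \<Rightarrow> (nat \<Rightarrow> real) \<Rightarrow> real \<Rightarrow> real" where
  "net_force K z t = (\<Sum>k\<in>K. charge_force h (z k) t) + g t"

definition super :: "(nat \<Rightarrow> real) \<Rightarrow> bool" where
  "super x \<longleftrightarrow> (\<forall>j\<in>{1..n}. net_force (others j) x (x j) \<le> 0)"

definition sub :: "(nat \<Rightarrow> real) \<Rightarrow> bool" where
  "sub x \<longleftrightarrow> (\<forall>j\<in>{1..n}. 0 \<le> net_force (others j) x (x j))"

lemma superD: "\<lbrakk>super x; j \<in> {1..n}\<rbrakk> \<Longrightarrow> net_force (others j) x (x j) \<le> 0"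
  by (simp add: super_def)

lemma subD: "\<lbrakk>sub x; j \<in> {1..n}\<rbrakk> \<Longrightarrow> 0 \<le> net_force (others j) x (x j)"
  by (simp add: sub_def)

text \<open>The configuration seen by charge \<open>j\<close> in mid-sweep, as in a Gauss-Seidel
  iteration: charges to its left have moved, those to its right have not.\<close>

definition mixed :: "nat \<Rightarrow> (nat \<Rightarrow> real) \<Rightarrow> (nat \<Rightarrow> real) \<Rightarrow> nat \<Rightarrow> real" where
  "mixed j x' x k = (if k < j then x' k else x k)"

text \<open>A relation, stated index by index, so that a sweep can be built charge by charge.
  Clearance from all charges, not only from the neighbours, is what the comparison of forces
  consumes.\<close>

definition swept :: "(nat \<Rightarrow> real) \<Rightarrow> (nat \<Rightarrow> real) \<Rightarrow> nat \<Rightarrow> bool" where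
  "swept x x' j \<longleftrightarrow> x' j \<in> I \<and> (\<forall>k. 1 \<le> k \<longrightarrow> k < j \<longrightarrow> x' k + h < x' j) \<and>
     (\<forall>k. j < k \<longrightarrow> k \<le> n \<longrightarrow> x' j + h < x k) \<and> net_force (others j) (mixed j x' x) (x' j) = 0"

definition sweep :: "(nat \<Rightarrow> real) \<Rightarrow> (nat \<Rightarrow> real) \<Rightarrow> bool" where
  "sweep x x' \<longleftrightarrow> (\<forall>j\<in>{1..n}. swept x x' j)"

lemma adm_iff:
  "adm x \<longleftrightarrow> (\<forall>j\<in>{1..n}. x j \<in> I) \<and> (\<forall>i j. 1 \<le> i \<longrightarrow> i < j \<longrightarrow> j \<le> n \<longrightarrow> x i + h < x j)"
  using h_pos by (intro admissible_iff) simp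

lemma admD:
  assumes "adm x"
  shows "j \<in> {1..n} \<Longrightarrow> x j \<in> I" "\<lbrakk>1 \<le> i; i < j; j \<le> n\<rbrakk> \<Longrightarrow> x i + h < x j"
  using assms by (auto simp: adm_iff)

lemma g_mono: "\<lbrakk>x \<in> I; y \<in> I; x \<le> y\<rbrakk> \<Longrightarrow> g y \<le> g x"
  using g_less [of x y] by (cases "x = y") auto

text \<open>Only relative positions count: each pair term and \<open>g\<close> decrease as the
  relative position and the point itself move right, as long as the pair stays on one side of the
  band.\<close>

lemma net_force_mono:
  assumes "finite K"
    and "\<And>k. k \<in> K \<Longrightarrow> h < t - w k \<or> s - z k < - h"
    and "\<And>k. k \<in> K \<Longrightarrow> t - w k \<le> s - z k"
    and "s \<in> I" "t \<in> I" "t \<le> s"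
  shows "net_force K z s \<le> net_force K w t"
  unfolding net_force_def using assms h_pos
  by (intro add_mono sum_mono g_mono) (auto simp: charge_force_diff [of h "z _"] charge_force_diff [of h "w _"]
     intro!: pair_force_antimono)

lemma net_force_less:
  assumes "finite K"
    and "\<And>k. k \<in> K \<Longrightarrow> h < t - w k \<or> s - z k < - h"
    and "\<And>k. k \<in> K \<Longrightarrow> t - w k \<le> s - z k"
    and "s \<in> I" "t \<in> I" "t < s"
  shows "net_force K z s < net_force K w t"
  unfolding net_force_def using assms h_pos
  by (intro add_le_less_mono sum_mono g_less) (auto simp: charge_force_diff [of h "z _"] charge_force_diff [of h "w _"]
     intro!: pair_force_antimono)

text \<open>A discrete maximum principle: maximality of \<open>w i - z i\<close> says exactly that
  \<open>z i - z k \<le> w i - w k\<close> for all \<open>k\<close>, so no pair term is larger for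
  \<open>w\<close>. If \<open>z i < w i\<close>, the strictly decreasing field then contradicts the
  signs of the two net forces.\<close>

lemma sub_le_super:
  assumes "adm w" "sub w" "adm z" "super z" "j \<in> {1..n}"
  shows "w j \<le> z j"
proof -
  define d where "d = (\<lambda>j. w j - z j)"
  have "Max (d ` {1..n}) \<in> d ` {1..n}"
    using assms(5) by (intro Max_in) auto
  then obtain i where "i \<in> {1..n}" "d i = Max (d ` {1..n})"
    by force
  then have i: "i \<in> {1..n}" "\<And>k. k \<in> {1..n} \<Longrightarrow> d k \<le> d i"
    by auto
  have "w i \<le> z i"
  proof (rule ccontr)
    assume "\<not> w i \<le> z i"
    then have less: "z i < w i" by simp
    have "net_force (others i) w (w i) < net_force (others i) z (z i)"
    proof (rule net_force_less [OF _ _ _ _ _ less])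
      fix k assume k: "k \<in> others i"
      show "h < z i - z k \<or> w i - w k < - h"
        using k i(1) admD(2) [OF assms(1), of i k] admD(2) [OF assms(3), of k i]
        by (cases "k < i") auto
      show "z i - z k \<le> w i - w k"
        using i(2) [of k] k by (simp add: d_def)
    qed (use i assms admD in auto)
    then show False
      using subD [OF assms(2) i(1)] superD [OF assms(4) i(1)] by linarith
  qed
  then show ?thesis
    using i(2) [OF assms(5)] by (simp add: d_def)
qed

section \<open>Monotonicity of a sweep\<close>

lemma sweep_adm: "sweep x x' \<Longrightarrow> adm x'"
  by (auto simp: sweep_def swept_def adm_iff)

lemma sweepD:
  assumes "sweep x x'"
  shows "\<lbrakk>1 \<le> j; j < k; k \<le> n\<rbrakk> \<Longrightarrow> x' j + h < x k"
    and "j \<in> {1..n} \<Longrightarrow> net_force (others j) (mixed j x' x) (x' j) = 0"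
  using assms by (auto simp: sweep_def swept_def)

text \<open>Inequalities replace the balance equations so that a sub- or supersolution can stand in
  as its own image under a sweep (\<open>mixed j x x = x\<close>). At index \<open>j\<close> the
  charges on the left are compared by induction, those on the right by assumption.\<close>

lemma sweep_comparison:
  assumes "adm x'" "adm y'"
    and x: "\<And>j k. \<lbrakk>1 \<le> j; j < k; k \<le> n\<rbrakk> \<Longrightarrow> x' j + h < x k"
    and "\<And>j. j \<in> {1..n} \<Longrightarrow> 0 \<le> net_force (others j) (mixed j x' x) (x' j)"
    and "\<And>j. j \<in> {1..n} \<Longrightarrow> net_force (others j) (mixed j y' y) (y' j) \<le> 0"
    and "\<And>j. j \<in> {1..n} \<Longrightarrow> x j \<le> y j"
    and "j \<in> {1..n}"
  shows "x' j \<le> y' j"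
  using assms(7)
proof (induction j rule: less_induct)
  case (less j)
  show ?case
  proof (rule ccontr)
    assume "\<not> x' j \<le> y' j"
    then have lt: "y' j < x' j" by simp
    have "net_force (others j) (mixed j x' x) (x' j) < net_force (others j) (mixed j y' y) (y' j)"
    proof (rule net_force_less [OF _ _ _ _ _ lt])
      fix k assume k: "k \<in> others j"
      show "h < y' j - mixed j y' y k \<or> x' j - mixed j x' x k < - h"
        using k less.prems x [of j k] admD(2) [OF assms(2), of k j]
        by (cases "k < j") (auto simp: mixed_def)
      show "y' j - mixed j y' y k \<le> x' j - mixed j x' x k"
        using k lt less.IH [of k] assms(6) [of k] by (auto simp: mixed_def)
    qed (use less.prems assms(1,2) admD in auto)
    then show False
      using assms(4) [OF less.prems] assms(5) [OF less.prems] by linarith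
  qed
qed

lemma mixed_self [simp]: "mixed j x x = x"
  by (auto simp: mixed_def)

lemma sweep_mono:
  assumes "sweep x x'" "sweep y y'" "\<And>j. j \<in> {1..n} \<Longrightarrow> x j \<le> y j" "j \<in> {1..n}"
  shows "x' j \<le> y' j"
  using sweep_adm [OF assms(1)] sweep_adm [OF assms(2)] sweepD(1) [OF assms(1)] _ _ assms(3,4)
  by (rule sweep_comparison) (simp_all only: sweepD(2) [OF assms(1)] sweepD(2) [OF assms(2)] order.refl)

lemma sweep_super_le:
  assumes "adm u" "super u" "sweep u u'" "j \<in> {1..n}"
  shows "u' j \<le> u j"
proof (rule sweep_comparison [where x = u and y = u])
  show "0 \<le> net_force (others j) (mixed j u' u) (u' j)" if "j \<in> {1..n}" for j
    by (simp only: sweepD(2) [OF assms(3) that])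
  show "net_force (others j) (mixed j u u) (u j) \<le> 0" if "j \<in> {1..n}" for j
    unfolding mixed_self by (rule superD [OF assms(2) that])
qed (use assms sweep_adm sweepD in auto)

lemma sweep_sub_ge:
  assumes "adm v" "sub v" "sweep v v'" "j \<in> {1..n}"
  shows "v j \<le> v' j"
proof (rule sweep_comparison [where x = v and y = v])
  show "net_force (others j) (mixed j v' v) (v' j) \<le> 0" if "j \<in> {1..n}" for j
    by (simp only: sweepD(2) [OF assms(3) that])
  show "0 \<le> net_force (others j) (mixed j v v) (v j)" if "j \<in> {1..n}" for j
    unfolding mixed_self by (rule subD [OF assms(2) that])
qed (use assms sweep_adm admD in auto)

text \<open>Charge \<open>j\<close> was balanced against the old positions of the charges on its
  right. These have moved left since, so they push it harder to the left.\<close>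

lemma sweep_super:
  assumes "adm u" "super u" "sweep u u'"
  shows "super u'"
  unfolding super_def
proof
  fix j assume j: "j \<in> {1..n}"
  have "net_force (others j) u' (u' j) \<le> net_force (others j) (mixed j u' u) (u' j)"
  proof (rule net_force_mono)
    fix k assume k: "k \<in> others j"
    show "h < u' j - mixed j u' u k \<or> u' j - u' k < - h"
      using k j admD(2) [OF sweep_adm [OF assms(3)], of k j] admD(2) [OF sweep_adm [OF assms(3)], of j k]
      by (cases "k < j") (auto simp: mixed_def)
    show "u' j - mixed j u' u k \<le> u' j - u' k"
      using k sweep_super_le [OF assms, of k] by (auto simp: mixed_def)
  qed (use j admD(1) [OF sweep_adm [OF assms(3)]] in auto)
  then show "net_force (others j) u' (u' j) \<le> 0"
    by (simp only: sweepD(2) [OF assms(3) j])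
qed

lemma sweep_sub:
  assumes "adm v" "sub v" "sweep v v'"
  shows "sub v'"
  unfolding sub_def
proof
  fix j assume j: "j \<in> {1..n}"
  have "net_force (others j) (mixed j v' v) (v' j) \<le> net_force (others j) v' (v' j)"
  proof (rule net_force_mono)
    fix k assume k: "k \<in> others j"
    show "h < v' j - v' k \<or> v' j - mixed j v' v k < - h"
      using k j sweepD(1) [OF assms(3), of j k] admD(2) [OF sweep_adm [OF assms(3)], of k j]
      by (cases "k < j") (auto simp: mixed_def)
    show "v' j - v' k \<le> v' j - mixed j v' v k"
      using k sweep_sub_ge [OF assms, of k] by (auto simp: mixed_def)
  qed (use j admD(1) [OF sweep_adm [OF assms(3)]] in auto)
  then show "0 \<le> net_force (others j) v' (v' j)"
    by (simp only: sweepD(2) [OF assms(3) j])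
qed

lemma sum_net_force:
  assumes "S \<subseteq> {1..n}"
  shows "(\<Sum>j\<in>S. net_force (others j) x (x j)) =
    (\<Sum>j\<in>S. \<Sum>k\<in>{1..n} - S. pair_force h (x j - x k)) + (\<Sum>j\<in>S. g (x j))"
proof -
  define c where "c = (\<lambda>j k. pair_force h (x j - x k))"
  have anti: "c j k = - c k j" for j k
    using pair_force_minus [of h "x j - x k"] by (simp add: c_def)
  have "(\<Sum>j\<in>S. \<Sum>k\<in>S. c j k) = (\<Sum>j\<in>S. \<Sum>k\<in>S. c k j)"
    by (rule sum.swap)
  also have "\<dots> = - (\<Sum>j\<in>S. \<Sum>k\<in>S. c j k)"
    unfolding sum_negf [symmetric] by (intro sum.cong refl anti)
  finally have zero: "(\<Sum>j\<in>S. \<Sum>k\<in>S. c j k) = 0" by simp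
  have "(\<Sum>k\<in>others j. charge_force h (x k) (x j)) = (\<Sum>k\<in>S. c j k) + (\<Sum>k\<in>{1..n} - S. c j k)" for j
  proof -
    \<comment> \<open>The index \<open>j\<close> itself may be included because
      \<open>pair_force h 0 = 0\<close>.\<close>
    have "(\<Sum>k\<in>others j. charge_force h (x k) (x j)) = (\<Sum>k\<in>{1..n}. c j k)"
      by (intro sum.mono_neutral_cong_left) (auto simp: c_def charge_force_diff [of h "x _"])
    also have "\<dots> = (\<Sum>k\<in>S. c j k) + (\<Sum>k\<in>{1..n} - S. c j k)"
      using assms by (simp add: sum.subset_diff)
    finally show ?thesis .
  qed
  then show ?thesis
    by (simp add: net_force_def sum.distrib zero) (simp add: c_def)
qed

section \<open>Limits of sweeps\<close>

text \<open>Allows statements about positions and net forces to be proved at one end only. A sweep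
  runs from left to right and is not preserved by reflection, so its properties are proved
  separately for sub- and supersolutions.\<close>

lemma reflected: "charge_field h (- b) (- a) (\<lambda>x. - g (- x))"
proof
  show "continuous_on (einterval (- b) (- a)) (\<lambda>x. - g (- x))"
    by (intro continuous_intros continuous_on_compose2 [OF g_cont]) (auto simp: einterval_uminus)
  have neg: "(\<exists>x\<in>einterval (- b) (- a). P x) \<longleftrightarrow> (\<exists>x\<in>I. P (- x))" for P
    unfolding Bex_def einterval_uminus by (metis minus_minus)
  show "\<exists>x\<in>einterval (- b) (- a). 0 < - g (- x)" "\<exists>x\<in>einterval (- b) (- a). - g (- x) < 0"
    unfolding neg using left_pos right_neg by auto
  show "\<exists>x\<in>einterval (- b) (- a). K < - g (- x)" if "- b \<noteq> - \<infinity>" for K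
  proof -
    have "b \<noteq> \<infinity>" using that by auto
    then obtain x where "x \<in> I" "g x < - K" using right_unbounded by blast
    then show ?thesis unfolding neg by force
  qed
  show "\<exists>x\<in>einterval (- b) (- a). - g (- x) < K" if "- a \<noteq> \<infinity>" for K
  proof -
    have "a \<noteq> - \<infinity>" using that by auto
    then obtain x where "x \<in> I" "- K < g x" using left_unbounded by blast
    then show ?thesis unfolding neg by force
  qed
qed (use h_pos g_less einterval_uminus in auto)

text \<open>One end of the segment for the intermediate value theorem. If a charge lies to the left
  of \<open>t0\<close>, its repulsion just beyond distance \<open>h\<close> outweighs everything
  else. Otherwise the field has to do it: by its unboundedness at a finite end, by its sign far out
  at an infinite one.\<close>

lemma pushed_right_exists:
  assumes "finite K" "t0 \<in> I"
    and z: "\<And>k. k \<in> K \<Longrightarrow> z k \<in> I" "\<And>k. k \<in> K \<Longrightarrow> h < \<bar>t0 - z k\<bar>"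
  shows "\<exists>t\<in>I. t \<le> t0 \<and> (\<forall>k\<in>K. z k < t0 \<longrightarrow> z k + h < t) \<and> 0 \<le> net_force K z t"
proof -
  define L where "L = {k\<in>K. z k < t0}"
  define R where "R = {k\<in>K. t0 < z k}"
  define C where "C = (\<Sum>k\<in>R. pair_force h (t0 - z k))"
  have fin: "finite L" "finite R" using assms(1) by (auto simp: L_def R_def)
  have "K = L \<union> R" "L \<inter> R = {}"
    using z(2) h_pos by (force simp: L_def R_def)+
  then have split: "net_force K z t = (\<Sum>k\<in>L. pair_force h (t - z k)) + (\<Sum>k\<in>R. pair_force h (t - z k)) + g t" for t
    using fin by (simp add: net_force_def charge_force_diff [of h "z _"] sum.union_disjoint)
  \<comment> \<open>Moving left from \<open>t0\<close> only weakens the leftward push of the charges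
    on the right.\<close>
  have R: "C \<le> (\<Sum>k\<in>R. pair_force h (t - z k))" if "t \<le> t0" for t
    unfolding C_def
  proof (intro sum_mono pair_force_antimono h_pos disjI2)
    show "t0 - z k < - h" if "k \<in> R" for k
      using that z(2) [of k] by (auto simp: R_def)
  qed (use that in auto)
  show ?thesis
  proof (cases "L = {}")
    case False
    then have "Max (z ` L) \<in> z ` L" using fin by (intro Max_in) auto
    then obtain m where m: "m \<in> L" "z m = Max (z ` L)" by force
    then have max: "z k \<le> z m" if "k \<in> L" for k
      using that fin by auto
    have "0 < t0 - (z m + h)"
      using m z(2) [of m] by (auto simp: L_def)
    \<comment> \<open>The repulsion of the nearest left charge is to outweigh \<open>C\<close> and
      \<open>g t0\<close>, which bound the charges on the right and the field from below at every
      point left of \<open>t0\<close>.\<close>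
    then obtain \<delta> where \<delta>: "0 < \<delta>" "\<delta> < t0 - (z m + h)" "pair_force h (h + \<delta>) > - (C + g t0)"
      using pair_force_unbounded [OF h_pos] by blast
    define t where "t = z m + h + \<delta>"
    have t: "t \<in> I" "t \<le> t0"
      using m \<delta> z(1) [of m] h_pos assms(2) einterval_between [of "z m" a b t0 t] by (auto simp: t_def L_def)
    have "pair_force h (t - z m) \<le> (\<Sum>k\<in>L. pair_force h (t - z k))"
    proof (rule member_le_sum [OF m(1) _ fin(1)])
      show "0 \<le> pair_force h (t - z k)" if "k \<in> L - {m}" for k
        using that max [of k] \<delta> h_pos by (intro less_imp_le pair_force_pos) (auto simp: t_def)
    qed
    moreover have "g t0 \<le> g t"
      using t assms(2) by (intro g_mono)
    ultimately have "0 \<le> net_force K z t"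
      unfolding split using R [OF t(2)] \<delta>(3) by (simp add: t_def)
    moreover have "z k + h < t" if "k \<in> K" "z k < t0" for k
      using max [of k] that \<delta> by (auto simp: L_def t_def)
    ultimately show ?thesis
      using t by blast
  next
    case True
    have "\<exists>t\<in>I. t \<le> t0 \<and> 0 \<le> (\<Sum>k\<in>R. pair_force h (t - z k)) + g t"
    proof (cases "a = - \<infinity>")
      case False
      then obtain s where s: "s \<in> I" "- C < g s" using left_unbounded by blast
      have t: "min s t0 \<in> I" using s assms(2) by (simp add: min_def)
      then have "g s \<le> g (min s t0)" using s by (intro g_mono) auto
      then show ?thesis
        using t R [of "min s t0"] s by (intro bexI [of _ "min s t0"]) auto
    next
      case True
      obtain s where s: "s \<in> I" "0 < g s" using left_pos by blast
      \<comment> \<open>The positive force \<open>g s\<close> is shared among the charges on the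
        right; the added 1 guards against an empty \<open>R\<close>.\<close>
      define \<epsilon> where "\<epsilon> = g s / (real (card R) + 1)"
      have \<epsilon>: "0 < \<epsilon>" "real (card R) * \<epsilon> \<le> g s"
        using s by (auto simp: \<epsilon>_def field_simps)
      obtain D where D: "h < D" "\<And>d. D \<le> d \<Longrightarrow> pair_force h d < \<epsilon>"
        using pair_force_vanishing [OF h_pos \<epsilon>(1)] by blast
      define t where "t = min s (t0 - D)"
      have "ereal t \<le> ereal s" by (simp add: t_def)
      moreover have "ereal s < b" using s by (simp add: einterval_iff)
      ultimately have "ereal t < b" by (rule le_less_trans)
      then have t: "t \<in> I" using True by (simp add: einterval_iff)
      have "- \<epsilon> \<le> pair_force h (t - z k)" if "k \<in> R" for k
      proof -
        have "D \<le> z k - t"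
          using that by (auto simp: R_def t_def min_def)
        then have "pair_force h (z k - t) < \<epsilon>"
          by (rule D(2))
        then show ?thesis
          using pair_force_minus [of h "z k - t"] by simp
      qed
      then have "real (card R) * (- \<epsilon>) \<le> (\<Sum>k\<in>R. pair_force h (t - z k))"
        by (intro sum_bounded_below)
      moreover have "g s \<le> g t" using s t by (intro g_mono) (auto simp: t_def)
      ultimately show ?thesis
        using t \<epsilon>(2) D(1) h_pos by (intro bexI [of _ t]) (auto simp: t_def)
    qed
    moreover have "\<not> z k < t0" if "k \<in> K" for k
      using True that by (auto simp: L_def)
    ultimately show ?thesis
      unfolding split True by auto
  qed
qed

lemma net_force_reflect:
  "charge_field.net_force h (\<lambda>x. - g (- x)) K (\<lambda>k. - z k) t = - net_force K z (- t)"
proof -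
  interpret refl: charge_field h "- b" "- a" "\<lambda>x. - g (- x)" n by (rule reflected)
  have "charge_force h (- z k) t = - charge_force h (z k) (- t)" for k
    using pair_force_minus [of h "- t - z k"]
    by (simp add: charge_force_diff [of h "z k"] charge_force_diff [of h "- z k"] add.commute)
  then show ?thesis
    by (simp add: refl.net_force_def net_force_def sum_negf)
qed

lemma pushed_left_exists:
  assumes "finite K" "t0 \<in> I"
    and "\<And>k. k \<in> K \<Longrightarrow> z k \<in> I" "\<And>k. k \<in> K \<Longrightarrow> h < \<bar>t0 - z k\<bar>"
  shows "\<exists>t\<in>I. t0 \<le> t \<and> (\<forall>k\<in>K. t0 < z k \<longrightarrow> t + h < z k) \<and> net_force K z t \<le> 0"
proof -
  interpret refl: charge_field h "- b" "- a" "\<lambda>x. - g (- x)" n by (rule reflected)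
  have "\<exists>t\<in>einterval (- b) (- a). t \<le> - t0 \<and> (\<forall>k\<in>K. - z k < - t0 \<longrightarrow> - z k + h < t) \<and>
      0 \<le> refl.net_force K (\<lambda>k. - z k) t"
    using assms by (intro refl.pushed_right_exists) (auto simp: einterval_uminus abs_minus_commute)
  then obtain t where t: "- t \<in> I" "t \<le> - t0" "\<And>k. k \<in> K \<Longrightarrow> t0 < z k \<Longrightarrow> - z k + h < t"
      "net_force K z (- t) \<le> 0"
    by (auto simp: einterval_uminus net_force_reflect)
  show ?thesis
    using t by (intro bexI [of _ "- t"]) force+
qed

section \<open>Existence of balance points and of sweeps\<close>

lemma balance_point_exists:
  assumes K: "finite K" "t0 \<in> I"
    and z: "\<And>k. k \<in> K \<Longrightarrow> z k \<in> I" "\<And>k. k \<in> K \<Longrightarrow> h < \<bar>t0 - z k\<bar>"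
  shows "\<exists>t\<in>I. (\<forall>k\<in>K. z k < t0 \<longrightarrow> z k + h < t) \<and> (\<forall>k\<in>K. t0 < z k \<longrightarrow> t + h < z k) \<and>
    net_force K z t = 0"
proof -
  obtain t1 where t1: "t1 \<in> I" "t1 \<le> t0" "\<And>k. k \<in> K \<Longrightarrow> z k < t0 \<Longrightarrow> z k + h < t1" "0 \<le> net_force K z t1"
    using pushed_right_exists [of K t0 z, OF assms] by auto
  obtain t2 where t2: "t2 \<in> I" "t0 \<le> t2" "\<And>k. k \<in> K \<Longrightarrow> t0 < z k \<Longrightarrow> t2 + h < z k" "net_force K z t2 \<le> 0"
    using pushed_left_exists [of K t0 z, OF assms] by auto
  have I: "{t1..t2} \<subseteq> I"
    by (auto intro: einterval_between [OF t1(1) t2(1)])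
  \<comment> \<open>The whole segment avoids the singular bands: \<open>t1\<close> already clears
    the charges left of \<open>t0\<close>, and \<open>t2\<close> those right of it.\<close>
  have "h < \<bar>s - z k\<bar>" if "s \<in> {t1..t2}" "k \<in> K" for s k
    using that t1(3) [of k] t2(3) [of k] z(2) [of k] h_pos by (cases "z k < t0") auto
  then have "continuous_on {t1..t2} (net_force K z)"
    unfolding net_force_def [abs_def] using h_pos
    by (intro continuous_intros continuous_on_charge_force continuous_on_subset [OF g_cont I]) auto
  then obtain t where t: "t1 \<le> t" "t \<le> t2" "net_force K z t = 0"
    using IVT2' [of "net_force K z" t2 0 t1] t1 t2 by auto
  then show ?thesis
    using I t1(3) t2(3) by (intro bexI [of _ t]) fastforce+
qed

lemma sweep_exists:
  assumes "adm x"
  shows "\<exists>x'. sweep x x'"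
proof -
  have "\<exists>x'. \<forall>j\<in>{1..m}. swept x x' j" if "m \<le> n" for m
    using that
  proof (induction m)
    case (Suc m)
    then obtain x' where "\<forall>j\<in>{1..m}. swept x x' j" by fastforce
    then have x': "swept x x' j" if "j \<in> {1..m}" for j using that by blast
    define z where "z = mixed (Suc m) x' x"
    \<comment> \<open>The old position of charge \<open>Suc m\<close> is a valid starting point,
      since every earlier charge was placed clear of the old positions on its right.\<close>
    have left: "x' k + h < x (Suc m)" if "k \<in> {1..m}" for k
      using x' [OF that] that Suc.prems by (auto simp: swept_def)
    have right: "x (Suc m) + h < x k" if "Suc m < k" "k \<le> n" for k
      using that admD(2) [OF assms] by auto
    have "\<exists>t\<in>I. (\<forall>k\<in>others (Suc m). z k < x (Suc m) \<longrightarrow> z k + h < t) \<and>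
        (\<forall>k\<in>others (Suc m). x (Suc m) < z k \<longrightarrow> t + h < z k) \<and> net_force (others (Suc m)) z t = 0"
    proof (rule balance_point_exists)
      show "x (Suc m) \<in> I" using Suc.prems admD [OF assms] by auto
      fix k assume k: "k \<in> others (Suc m)"
      show "z k \<in> I"
        using k x' [of k] admD(1) [OF assms] by (auto simp: z_def mixed_def swept_def)
      show "h < \<bar>x (Suc m) - z k\<bar>"
        using k left [of k] right [of k] by (cases "k < Suc m") (auto simp: z_def mixed_def)
    qed simp
    then obtain t where t: "t \<in> I" "net_force (others (Suc m)) z t = 0"
      and t': "\<And>k. k \<in> others (Suc m) \<Longrightarrow> z k < x (Suc m) \<Longrightarrow> z k + h < t"
        "\<And>k. k \<in> others (Suc m) \<Longrightarrow> x (Suc m) < z k \<Longrightarrow> t + h < z k"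
      by auto
    define x'' where "x'' = x'(Suc m := t)"
    \<comment> \<open>\<open>mixed j\<close> reads new positions only below \<open>j\<close>, so
      placing charge \<open>Suc m\<close> leaves the earlier balances intact.\<close>
    have mixed: "mixed j x'' x = mixed j x' x" if "j \<le> Suc m" for j
      using that by (auto simp: mixed_def x''_def)
    have "swept x x'' j" if "j \<in> {1..Suc m}" for j
    proof (cases "j = Suc m")
      case True
      have "x'' k + h < t" if "1 \<le> k" "k < Suc m" for k
        using t'(1) [of k] left [of k] that Suc.prems h_pos by (auto simp: z_def mixed_def x''_def)
      moreover have "t + h < x k" if "Suc m < k" "k \<le> n" for k
        using t'(2) [of k] right [of k] that Suc.prems h_pos by (auto simp: z_def mixed_def)
      moreover have "x'' (Suc m) = t" by (simp add: x''_def)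
      ultimately show ?thesis
        unfolding swept_def using True t mixed [of "Suc m"] by (simp add: z_def)
    next
      case False
      then show ?thesis
        using that x' [of j] mixed [of j] by (auto simp: swept_def x''_def)
    qed
    then show ?case by blast
  qed auto
  from this [of n] show ?thesis
    by (auto simp: sweep_def)
qed

section \<open>Bounds on the gaps and passage to the limit\<close>

lemma super_gap:
  assumes "adm x" "super x" "1 \<le> i" "i < j" "j \<le> n"
  shows "pair_force h (x j - x i) \<le> - (\<Sum>k\<in>{j..n}. g (x k))"
proof -
  have pos: "0 \<le> pair_force h (x k - x l)" if "k \<in> {j..n}" "l \<in> {1..n} - {j..n}" for k l
    using that admD(2) [OF assms(1), of l k] h_pos by (intro less_imp_le pair_force_pos) auto
  \<comment> \<open>All forces across the cut before \<open>j\<close> push to the right, so a single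
    one is at most their total.\<close>
  have "pair_force h (x j - x i) \<le> (\<Sum>l\<in>{1..n} - {j..n}. pair_force h (x j - x l))"
    using assms pos by (intro member_le_sum) auto
  also have "\<dots> \<le> (\<Sum>k\<in>{j..n}. \<Sum>l\<in>{1..n} - {j..n}. pair_force h (x k - x l))"
    by (rule member_le_sum [of _ _ "\<lambda>k. \<Sum>l\<in>{1..n} - {j..n}. pair_force h (x k - x l)"])
      (use assms pos in \<open>auto intro!: sum_nonneg\<close>)
  also have "\<dots> + (\<Sum>k\<in>{j..n}. g (x k)) = (\<Sum>k\<in>{j..n}. net_force (others k) x (x k))"
    using assms by (intro sum_net_force [symmetric]) auto
  also have "\<dots> \<le> 0"
    using assms by (intro sum_nonpos superD) auto
  finally show ?thesis by simp
qed

lemma sub_gap: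
  assumes "adm x" "sub x" "1 \<le> i" "i < j" "j \<le> n"
  shows "pair_force h (x j - x i) \<le> (\<Sum>k\<in>{1..i}. g (x k))"
proof -
  have pos: "0 \<le> pair_force h (x l - x k)" if "k \<in> {1..i}" "l \<in> {1..n} - {1..i}" for k l
    using that admD(2) [OF assms(1), of k l] h_pos by (intro less_imp_le pair_force_pos) auto
  have "pair_force h (x j - x i) \<le> (\<Sum>l\<in>{1..n} - {1..i}. pair_force h (x l - x i))"
    by (rule member_le_sum [of _ _ "\<lambda>l. pair_force h (x l - x i)"])
      (use assms pos in auto)
  also have "\<dots> \<le> (\<Sum>k\<in>{1..i}. \<Sum>l\<in>{1..n} - {1..i}. pair_force h (x l - x k))"
    by (rule member_le_sum [of _ _ "\<lambda>k. \<Sum>l\<in>{1..n} - {1..i}. pair_force h (x l - x k)"])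
      (use assms pos in \<open>auto intro!: sum_nonneg\<close>)
  also have "\<dots> = - (\<Sum>k\<in>{1..i}. \<Sum>l\<in>{1..n} - {1..i}. pair_force h (x k - x l))"
    unfolding sum_negf [symmetric] pair_force_minus [symmetric] by simp
  also have "\<dots> = (\<Sum>k\<in>{1..i}. g (x k)) - (\<Sum>k\<in>{1..i}. net_force (others k) x (x k))"
    using assms by (subst sum_net_force) auto
  also have "\<dots> \<le> (\<Sum>k\<in>{1..i}. g (x k))"
    using sum_nonneg [of "{1..i}" "\<lambda>k. net_force (others k) x (x k)"] subD [OF assms(2)] assms(4,5) by auto
  finally show ?thesis .
qed

text \<open>Bounded pair forces keep each distance above \<open>h\<close> by a margin independent of
  the stage, which survives in the limit. There the forces are continuous, and old and new positions
  share their limits, so the balance equations of the sweeps pass over.\<close>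

lemma sweep_limit:
  assumes U: "\<And>l. adm (U l)" "\<And>l. sweep (U l) (U (Suc l))"
    and lim: "\<And>j. j \<in> {1..n} \<Longrightarrow> (\<lambda>l. U l j) \<longlonglongrightarrow> w j"
    and w: "\<And>j. j \<in> {1..n} \<Longrightarrow> w j \<in> I"
    and gap: "\<And>i j. \<lbrakk>1 \<le> i; i < j; j \<le> n\<rbrakk> \<Longrightarrow> \<exists>C. \<forall>l. pair_force h (U l j - U l i) \<le> C"
  shows "adm w" "super w" "sub w"
proof -
  have "w i + h < w j" if ij: "1 \<le> i" "i < j" "j \<le> n" for i j
  proof -
    obtain C where C: "\<And>l. pair_force h (U l j - U l i) \<le> C" using gap ij by blast
    obtain \<delta> where \<delta>: "0 < \<delta>" "pair_force h (h + \<delta>) > C"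
      using pair_force_unbounded [OF h_pos zero_less_one, of C] by blast
    have "h + \<delta> \<le> U l j - U l i" for l
    proof (rule ccontr)
      assume "\<not> ?thesis"
      then have "pair_force h (h + \<delta>) \<le> pair_force h (U l j - U l i)"
        using h_pos admD(2) [OF U(1), of i j l] ij by (intro pair_force_antimono) auto
      then show False using C [of l] \<delta>(2) by simp
    qed
    moreover have "(\<lambda>l. U l j - U l i) \<longlonglongrightarrow> w j - w i"
      using ij by (intro tendsto_diff lim) auto
    ultimately have "h + \<delta> \<le> w j - w i"
      by (intro LIMSEQ_le_const) auto
    then show ?thesis using \<delta>(1) by simp
  qed
  then show adm: "adm w" using w by (simp add: adm_iff)
  have zero: "net_force (others j) w (w j) = 0" if j: "j \<in> {1..n}" for j
  proof -
    have lim': "(\<lambda>l. U (Suc l) k) \<longlonglongrightarrow> w k" if "k \<in> {1..n}" for k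
      using lim [OF that] by (rule LIMSEQ_Suc)
    have "(\<lambda>l. charge_force h (mixed j (U (Suc l)) (U l) k) (U (Suc l) j)) \<longlonglongrightarrow> charge_force h (w k) (w j)"
      if k: "k \<in> others j" for k
    proof -
      have "(\<lambda>l. mixed j (U (Suc l)) (U l) k) \<longlonglongrightarrow> w k"
        using k lim [of k] lim' [of k] by (cases "k < j") (auto simp: mixed_def)
      then have "(\<lambda>l. U (Suc l) j - mixed j (U (Suc l)) (U l) k) \<longlonglongrightarrow> w j - w k"
        by (intro tendsto_diff lim' j)
      moreover have "h < \<bar>w j - w k\<bar>"
        using k j admD(2) [OF adm, of j k] admD(2) [OF adm, of k j] by (cases "k < j") auto
      ultimately show ?thesis
        unfolding charge_force_diff [of h "mixed _ _ _ _"] charge_force_diff [of h "w _"]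
        using h_pos by (intro tendsto_pair_force)
    qed
    moreover have "(\<lambda>l. g (U (Suc l) j)) \<longlonglongrightarrow> g (w j)"
    proof (rule isCont_tendsto_compose [OF _ lim' [OF j]])
      show "isCont g (w j)"
        using g_cont w [OF j] by (simp add: continuous_on_eq_continuous_at)
    qed
    ultimately have "(\<lambda>l. net_force (others j) (mixed j (U (Suc l)) (U l)) (U (Suc l) j)) \<longlonglongrightarrow> net_force (others j) w (w j)"
      unfolding net_force_def by (intro tendsto_intros)
    then show ?thesis
      unfolding sweepD(2) [OF U(2) j] by (simp add: LIMSEQ_const_iff)
  qed
  show "super w"
    unfolding super_def by (intro ballI eq_refl zero)
  show "sub w"
    unfolding sub_def by (intro ballI eq_refl zero [symmetric])
qed

text \<open>\<open>v\<close> is the barrier: it bounds the decreasing iterates from below and, lying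
  in the open interval itself, keeps the limit inside.\<close>

lemma super_limit:
  assumes "adm (U 0)" "super (U 0)" "\<And>l. sweep (U l) (U (Suc l))" "adm v" "sub v"
  shows "\<exists>w. adm w \<and> super w \<and> sub w \<and> (\<forall>j\<in>{1..n}. (\<lambda>l. U l j) \<longlonglongrightarrow> w j)"
proof -
  have U: "adm (U l) \<and> super (U l)" for l
    by (induction l) (use assms sweep_adm sweep_super in blast)+
  have v: "v j \<le> U l j" if "j \<in> {1..n}" for l j
    using sub_le_super [OF assms(4,5)] U that by blast
  have dec: "decseq (\<lambda>l. U l j)" if "j \<in> {1..n}" for j
    unfolding decseq_Suc_iff using sweep_super_le U assms(3) that by blast
  have "\<exists>L. (\<lambda>l. U l j) \<longlonglongrightarrow> L \<and> (\<forall>l. L \<le> U l j)" if "j \<in> {1..n}" for j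
    using decseq_convergent [OF dec [OF that]] v [OF that] by metis
  then obtain w where w: "\<And>j. j \<in> {1..n} \<Longrightarrow> (\<lambda>l. U l j) \<longlonglongrightarrow> w j" "\<And>j l. j \<in> {1..n} \<Longrightarrow> w j \<le> U l j"
    by metis
  have I: "w j \<in> I" if "j \<in> {1..n}" for j
  proof (rule einterval_between)
    show "v j \<le> w j" using w(1) [OF that] v [OF that] by (intro LIMSEQ_le_const) auto
  qed (use w(2) [OF that] admD(1) assms(1,4) that in auto)
  have gap: "\<exists>C. \<forall>l. pair_force h (U l j - U l i) \<le> C" if ij: "1 \<le> i" "i < j" "j \<le> n" for i j
  proof (intro exI allI)
    fix l
    have "pair_force h (U l j - U l i) \<le> - (\<Sum>k\<in>{j..n}. g (U l k))"
      using U ij by (intro super_gap) auto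
    \<comment> \<open>As the charges move left the field forces grow, so the bound is worst at stage
      0.\<close>
    also have "\<dots> \<le> - (\<Sum>k\<in>{j..n}. g (U 0 k))"
      unfolding neg_le_iff_le using ij U admD(1) dec
      by (intro sum_mono g_mono) (auto simp: decseq_def)
    finally show "pair_force h (U l j - U l i) \<le> - (\<Sum>k\<in>{j..n}. g (U 0 k))" .
  qed
  show ?thesis
    using sweep_limit [of U w] U assms(3) w(1) I gap by blast
qed

lemma sub_limit:
  assumes "adm (U 0)" "sub (U 0)" "\<And>l. sweep (U l) (U (Suc l))" "adm v" "super v"
  shows "\<exists>w. adm w \<and> super w \<and> sub w \<and> (\<forall>j\<in>{1..n}. (\<lambda>l. U l j) \<longlonglongrightarrow> w j)"
proof -
  have U: "adm (U l) \<and> sub (U l)" for l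
    by (induction l) (use assms sweep_adm sweep_sub in blast)+
  have v: "U l j \<le> v j" if "j \<in> {1..n}" for l j
    using sub_le_super [OF _ _ assms(4,5)] U that by blast
  have inc: "incseq (\<lambda>l. U l j)" if "j \<in> {1..n}" for j
    unfolding incseq_Suc_iff using sweep_sub_ge U assms(3) that by blast
  have "\<exists>L. (\<lambda>l. U l j) \<longlonglongrightarrow> L \<and> (\<forall>l. U l j \<le> L)" if "j \<in> {1..n}" for j
    using incseq_convergent [OF inc [OF that]] v [OF that] by metis
  then obtain w where w: "\<And>j. j \<in> {1..n} \<Longrightarrow> (\<lambda>l. U l j) \<longlonglongrightarrow> w j" "\<And>j l. j \<in> {1..n} \<Longrightarrow> U l j \<le> w j"
    by metis
  have I: "w j \<in> I" if "j \<in> {1..n}" for j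
  proof (rule einterval_between)
    show "w j \<le> v j" using w(1) [OF that] v [OF that] by (intro LIMSEQ_le_const2) auto
  qed (use w(2) [OF that] admD(1) assms(1,4) that in auto)
  have gap: "\<exists>C. \<forall>l. pair_force h (U l j - U l i) \<le> C" if ij: "1 \<le> i" "i < j" "j \<le> n" for i j
  proof (intro exI allI)
    fix l
    have "pair_force h (U l j - U l i) \<le> (\<Sum>k\<in>{1..i}. g (U l k))"
      using U ij by (intro sub_gap) auto
    also have "\<dots> \<le> (\<Sum>k\<in>{1..i}. g (U 0 k))"
      using ij U admD(1) inc by (intro sum_mono g_mono) (auto simp: incseq_def)
    finally show "pair_force h (U l j - U l i) \<le> (\<Sum>k\<in>{1..i}. g (U 0 k))" .
  qed
  show ?thesis
    using sweep_limit [of U w] U assms(3) w(1) I gap by blast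
qed

section \<open>Sub- and supersolutions beyond a given distribution\<close>

text \<open>A certificate for supersolutions: at most \<open>n\<close> repulsions from the left of
  size \<open>M\<close>, against the push \<open>P\<close> of the right neighbour. Charges further
  right only help and are estimated by \<open>M\<close> as well.\<close>

lemma net_force_left_bound:
  assumes "adm x" "j \<in> {1..n}" "0 \<le> M"
    and M: "\<And>k. 1 \<le> k \<Longrightarrow> k < j \<Longrightarrow> pair_force h (x j - x k) \<le> M"
    and P: "j < n \<Longrightarrow> P \<le> pair_force h (x (Suc j) - x j)" "j = n \<Longrightarrow> P = 0"
  shows "net_force (others j) x (x j) \<le> real n * M - P + g (x j)"
proof -
  define T where "T = others j - {Suc j}"
  have "(\<Sum>k\<in>others j. pair_force h (x j - x k)) \<le> (\<Sum>k\<in>T. pair_force h (x j - x k)) - P"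
  proof (cases "j < n")
    case True
    then have "(\<Sum>k\<in>others j. pair_force h (x j - x k)) =
        pair_force h (x j - x (Suc j)) + (\<Sum>k\<in>T. pair_force h (x j - x k))"
      unfolding T_def by (intro sum.remove) auto
    then show ?thesis
      using P(1) [OF True] pair_force_minus [of h "x (Suc j) - x j"] by simp
  next
    case False
    then have "T = others j" "P = 0" using assms(2) P(2) by (auto simp: T_def)
    then show ?thesis by simp
  qed
  also have "(\<Sum>k\<in>T. pair_force h (x j - x k)) \<le> (\<Sum>k\<in>T. M)"
  proof (rule sum_mono)
    fix k assume k: "k \<in> T"
    show "pair_force h (x j - x k) \<le> M"
    proof (cases "k < j")
      case False
      then have "x j + h < x k" using k admD(2) [OF assms(1), of j k] assms(2) by (auto simp: T_def)
      then have "pair_force h (x j - x k) < 0" using h_pos by (intro pair_force_neg) auto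
      then show ?thesis using assms(3) by simp
    qed (use k M in \<open>auto simp: T_def\<close>)
  qed
  also have "\<dots> \<le> real n * M"
  proof -
    have "card T \<le> card {1..n}" by (intro card_mono) (auto simp: T_def)
    then show ?thesis using assms(3) by (simp add: mult_right_mono)
  qed
  finally show ?thesis
    by (simp add: net_force_def charge_force_diff [of h "x _"])
qed

text \<open>All charges are put beyond \<open>p\<close>, where the field force stays at or below
  \<open>g p < 0\<close>, and beyond \<open>x0\<close>. The spacing \<open>R\<close> makes the pair
  forces so weak that \<open>n\<close> of them cannot exceed \<open>- g p\<close>.\<close>

lemma super_exists_unbounded:
  assumes "adm x0" "b = \<infinity>"
  shows "\<exists>u. adm u \<and> super u \<and> (\<forall>j\<in>{1..n}. x0 j \<le> u j)"
proof -
  obtain p where p: "p \<in> I" "g p < 0" using right_neg by blast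
  define \<epsilon> where "\<epsilon> = - g p / (real n + 1)"
  have \<epsilon>: "0 < \<epsilon>" "real n * \<epsilon> \<le> - g p"
    using p by (auto simp: \<epsilon>_def field_simps)
  obtain R where R: "h < R" "\<And>d. R \<le> d \<Longrightarrow> pair_force h d < \<epsilon>"
    using pair_force_vanishing [OF h_pos \<epsilon>(1)] by blast
  define M where "M = p + (\<Sum>j\<in>{1..n}. \<bar>x0 j\<bar> + \<bar>p\<bar>)"
  define u where "u = (\<lambda>j. M + real j * R)"
  have big: "x0 j \<le> M \<and> p \<le> M" if "j \<in> {1..n}" for j
  proof -
    have "\<bar>x0 j\<bar> + \<bar>p\<bar> \<le> (\<Sum>j\<in>{1..n}. \<bar>x0 j\<bar> + \<bar>p\<bar>)"
      using that by (intro member_le_sum) auto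
    then show ?thesis by (auto simp: M_def)
  qed
  have pu: "p \<le> u j" "x0 j \<le> u j" if "j \<in> {1..n}" for j
    using big [OF that] R(1) h_pos by (auto simp: u_def intro: add_increasing2)
  have I: "u j \<in> I" if "j \<in> {1..n}" for j
    using pu(1) [OF that] p(1) assms(2) unfolding einterval_iff
    by (auto intro: less_le_trans [of a "ereal p"])
  have diff: "R \<le> u j - u i" if "i < j" for i j
  proof -
    have "1 * R \<le> (real j - real i) * R"
      using that R(1) h_pos by (intro mult_right_mono) auto
    then show ?thesis by (simp add: u_def algebra_simps)
  qed
  have adm: "adm u"
    unfolding adm_iff using I R(1) diff by (smt (verit))
  have "super u"
    unfolding super_def
  proof
    fix j assume j: "j \<in> {1..n}"
    have "net_force (others j) u (u j) \<le> real n * \<epsilon> - 0 + g (u j)"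
    proof (rule net_force_left_bound [OF adm j])
      show "pair_force h (u j - u k) \<le> \<epsilon>" if "k < j" for k
        using R(2) diff [OF that] by (simp add: less_imp_le)
      show "0 \<le> pair_force h (u (Suc j) - u j)"
        using diff [of j "Suc j"] R(1) h_pos by (intro less_imp_le pair_force_pos) auto
    qed (use \<epsilon> in auto)
    also have "\<dots> \<le> 0"
      using \<epsilon>(2) g_mono [OF p(1) I [OF j] pu(1) [OF j]] by simp
    finally show "net_force (others j) u (u j) \<le> 0" .
  qed
  with adm pu(2) show ?thesis by blast
qed

text \<open>The gaps \<open>h + \<delta> i\<close> are chosen so small, each in terms of the previous one, that the
  attraction towards the right neighbour (and, for the last charge, the field close to \<open>b\<close>)
  outweighs all repulsion from the left.\<close>

lemma super_exists_bounded:
  assumes "adm x0" "b = ereal b'"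
  shows "\<exists>u. adm u \<and> super u \<and> (\<forall>j\<in>{1..n}. x0 j \<le> u j)"
proof (cases "n = 0")
  case True
  then have "super x0" unfolding super_def by simp
  then show ?thesis using assms(1) by blast
next
  case False
  \<comment> \<open>The room between \<open>x0 n\<close> and \<open>b'\<close> is shared equally:
    the excesses \<open>\<delta> i\<close> of the gaps and the margin \<open>e\<close> before
    \<open>b'\<close> are at most \<open>m\<close> each, which keeps
    \<open>x0 j \<le> u j\<close>.\<close>
  define m where "m = (b' - x0 n) / real n"
  have "x0 n \<in> I" using admD(1) [OF assms(1), of n] False by auto
  then have "x0 n < b'" using assms(2) by (auto simp: einterval_iff)
  then have m: "0 < m" "real n * m = b' - x0 n" using False by (auto simp: m_def)
  \<comment> \<open>\<open>g (x0 1)\<close> bounds the field from above at all new positions, none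
    of which lies to the left of \<open>x0 1\<close>.\<close>
  have "\<exists>\<delta>. \<forall>i. (0 < \<delta> i \<and> \<delta> i < m) \<and>
      \<bar>g (x0 1)\<bar> + real n * pair_force h (h + \<delta> i) \<le> pair_force h (h + \<delta> (Suc i))"
  proof (rule dependent_nat_choice)
    show "\<exists>d. 0 < d \<and> d < m" using m(1) by (rule dense)
    show "\<exists>d'. (0 < d' \<and> d' < m) \<and> \<bar>g (x0 1)\<bar> + real n * pair_force h (h + d) \<le> pair_force h (h + d')" for d i
      using pair_force_unbounded [OF h_pos m(1)] by (metis less_imp_le)
  qed
  then obtain \<delta> where \<delta>: "\<And>i. 0 < \<delta> i" "\<And>i. \<delta> i < m"
    "\<And>i. \<bar>g (x0 1)\<bar> + real n * pair_force h (h + \<delta> i) \<le> pair_force h (h + \<delta> (Suc i))"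
    by blast
  have "b \<noteq> \<infinity>" using assms(2) by simp
  \<comment> \<open>Beyond \<open>s\<close> the field alone defeats the repulsion on the last
    charge, which has no right neighbour to push it back.\<close>
  then obtain s where s: "s \<in> I" "g s < - real n * pair_force h (h + \<delta> (n - 1))"
    using right_unbounded by blast
  have sb: "s < b'" using s(1) assms(2) by (simp add: einterval_iff)
  define e where "e = min m (b' - s)"
  have e: "0 < e" "e \<le> m" "s \<le> b' - e" using sb m by (auto simp: e_def)
  define u where "u = (\<lambda>j. b' - (real n - real j) * h - e - (\<Sum>i\<in>{j..<n}. \<delta> i))"
  have step: "u (Suc j) - u j = h + \<delta> j" if "j < n" for j
    using that by (simp add: u_def sum.atLeast_Suc_lessThan algebra_simps)
  have ge: "x0 j \<le> u j" if j: "j \<in> {1..n}" for j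
  proof -
    have "x0 i + (real n - real i) * h \<le> x0 n" if "i \<le> n" "1 \<le> i" for i
      using that
    proof (induction i rule: inc_induct)
      case (step i)
      then have "x0 i + h < x0 (Suc i)" using admD(2) [OF assms(1), of i "Suc i"] by auto
      then show ?case using step by (simp add: algebra_simps)
    qed simp
    then have "x0 j + (real n - real j) * h \<le> x0 n" using j by simp
    moreover have "(\<Sum>i\<in>{j..<n}. \<delta> i) \<le> (\<Sum>i\<in>{j..<n}. m)"
      using \<delta>(2) by (intro sum_mono less_imp_le)
    moreover have "(\<Sum>i\<in>{j..<n}. m) + m \<le> real n * m"
    proof -
      have "(real (n - j) + 1) * m \<le> real n * m" using j m by (intro mult_right_mono) auto
      then show ?thesis by (simp add: algebra_simps)
    qed
    ultimately show ?thesis using e(2) m(2) by (simp add: u_def)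
  qed
  have I: "u j \<in> I" if j: "j \<in> {1..n}" for j
  proof -
    have "0 \<le> (\<Sum>i\<in>{j..<n}. \<delta> i)" using \<delta>(1) by (intro sum_nonneg less_imp_le)
    moreover have "0 \<le> (real n - real j) * h" using j h_pos by simp
    ultimately have "u j < b'" using e(1) by (simp add: u_def)
    moreover have "a < ereal (u j)"
      using admD(1) [OF assms(1) j] ge [OF j] less_le_trans [of a "ereal (x0 j)" "ereal (u j)"]
      by (simp add: einterval_iff)
    ultimately show ?thesis using assms(2) by (simp add: einterval_iff)
  qed
  have adm: "adm u"
  proof (rule admissible_if_neighbours)
    show "u j + h < u (Suc j)" if "j < n" for j
      using step [OF that] \<delta>(1) [of j] by simp
  qed (use I h_pos in auto)
  have "super u"
    unfolding super_def
  proof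
    fix j assume j: "j \<in> {1..n}"
    \<comment> \<open>For \<open>j = 1\<close> the gap \<open>\<delta> 0\<close> is fictitious: it
      starts the recursion, and there is no charge on the left.\<close>
    define M where "M = pair_force h (h + \<delta> (j - 1))"
    define P where "P = (if j < n then pair_force h (h + \<delta> j) else 0)"
    have "net_force (others j) u (u j) \<le> real n * M - P + g (u j)"
    proof (rule net_force_left_bound [OF adm j])
      show "0 \<le> M"
        unfolding M_def using \<delta>(1) h_pos by (intro less_imp_le pair_force_pos) auto
      show "pair_force h (u j - u k) \<le> M" if k: "1 \<le> k" "k < j" for k
      proof -
        have "u k \<le> u (j - 1)"
        proof (cases "k = j - 1")
          case False
          then have "k < j - 1" "j - 1 \<le> n" using k j by auto
          then show ?thesis using admD(2) [OF adm k(1), of "j - 1"] h_pos by simp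
        qed simp
        moreover have "u j - u (j - 1) = h + \<delta> (j - 1)"
          using step [of "j - 1"] j by auto
        ultimately show ?thesis
          unfolding M_def using h_pos \<delta>(1) [of "j - 1"] by (intro pair_force_antimono) auto
      qed
      show "P \<le> pair_force h (u (Suc j) - u j)" if "j < n"
        using that by (simp add: P_def step)
    qed (simp add: P_def)
    also have "\<dots> \<le> 0"
    proof (cases "j < n")
      case True
      have "x0 1 \<le> x0 j"
        using j admD(2) [OF assms(1), of 1 j] h_pos by (cases "j = 1") auto
      then have "g (u j) \<le> g (x0 1)"
        using ge [OF j] I [OF j] admD(1) [OF assms(1), of 1] False by (intro g_mono) auto
      moreover have "\<bar>g (x0 1)\<bar> + real n * M \<le> P"
        using \<delta>(3) [of "j - 1"] j True by (simp add: M_def P_def)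
      ultimately show ?thesis by linarith
    next
      case False
      then have "j = n" using j by simp
      moreover have "g (u j) \<le> g s"
        using e(3) s(1) I [OF j] \<open>j = n\<close> by (intro g_mono) (auto simp: u_def)
      ultimately show ?thesis
        using s(2) by (simp add: M_def P_def)
    qed
    finally show "net_force (others j) u (u j) \<le> 0" .
  qed
  with adm ge show ?thesis by blast
qed

lemma super_exists:
  assumes "adm x0"
  shows "\<exists>u. adm u \<and> super u \<and> (\<forall>j\<in>{1..n}. x0 j \<le> u j)"
proof (cases b)
  case MInf
  then have "I = {}" by (auto simp: einterval_iff)
  then show ?thesis using left_pos by simp
qed (use assms super_exists_bounded super_exists_unbounded in auto)

lemma sub_exists:
  assumes "adm x0"
  shows "\<exists>v. adm v \<and> sub v \<and> (\<forall>j\<in>{1..n}. v j \<le> x0 j)"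
proof -
  interpret refl: charge_field h "- b" "- a" "\<lambda>x. - g (- x)" n by (rule reflected)
  \<comment> \<open>Reflection reverses the order of the charges, so the indices are reversed along
    with it.\<close>
  define r where "r = (\<lambda>j. Suc n - j)"
  have r: "r j \<in> {1..n}" "r (r j) = j" if "j \<in> {1..n}" for j
    using that by (auto simp: r_def)
  have less: "1 \<le> r j" "r j < r i" "r i \<le> n" if "1 \<le> i" "i < j" "j \<le> n" for i j
    using that by (auto simp: r_def)
  have adm: "refl.adm (\<lambda>j. - x (r j))" if "adm x" for x
    unfolding refl.adm_iff
  proof (intro conjI ballI allI impI)
    show "- x (r j) \<in> refl.I" if "j \<in> {1..n}" for j
      using admD(1) [OF \<open>adm x\<close> r(1) [OF that]] by (simp add: einterval_uminus)
    show "- x (r i) + h < - x (r j)" if "1 \<le> i" "i < j" "j \<le> n" for i j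
      using admD(2) [OF \<open>adm x\<close> less [OF that]] by simp
  qed
  have adm': "adm (\<lambda>j. - x (r j))" if "refl.adm x" for x
    unfolding adm_iff
  proof (intro conjI ballI allI impI)
    show "- x (r j) \<in> I" if "j \<in> {1..n}" for j
      using refl.admD(1) [OF \<open>refl.adm x\<close> r(1) [OF that]] by (simp add: einterval_uminus)
    show "- x (r i) + h < - x (r j)" if "1 \<le> i" "i < j" "j \<le> n" for i j
      using refl.admD(2) [OF \<open>refl.adm x\<close> less [OF that]] by simp
  qed
  obtain u where u: "refl.adm u" "refl.super u" "\<And>j. j \<in> {1..n} \<Longrightarrow> - x0 (r j) \<le> u j"
    using refl.super_exists [OF adm [OF assms]] by auto
  define v where "v = (\<lambda>j. - u (r j))"
  have "0 \<le> net_force (others j) v (v j)" if j: "j \<in> {1..n}" for j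
  proof -
    have "bij_betw r (others j) (others (r j))"
      by (rule bij_betw_byWitness [where f' = r]) (use j in \<open>auto simp: r_def\<close>)
    then have "net_force (others j) (\<lambda>k. - u (r k)) t = net_force (others (r j)) (\<lambda>k. - u k) t" for t
      unfolding net_force_def by (simp add: sum.reindex_bij_betw [of r _ _ "\<lambda>k. charge_force h (- u k) t"])
    moreover have "refl.net_force (others (r j)) (\<lambda>k. - (- u k)) (u (r j)) = - net_force (others (r j)) (\<lambda>k. - u k) (- u (r j))"
      by (rule net_force_reflect)
    ultimately show ?thesis
      using refl.superD [OF u(2) r(1) [OF j]] by (simp add: v_def)
  qed
  then have "sub v" by (simp add: sub_def)
  moreover have "v j \<le> x0 j" if "j \<in> {1..n}" for j
    using u(3) [OF r(1) [OF that]] r(2) [OF that] by (simp add: v_def)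
  moreover have "adm v"
    unfolding v_def by (rule adm' [OF u(1)])
  ultimately show ?thesis by blast
qed

section \<open>Convergence from arbitrary initial data\<close>

lemma sweep_sequence_exists:
  assumes "adm x0"
  shows "\<exists>X. X 0 = x0 \<and> (\<forall>l. adm (X l)) \<and> (\<forall>l. sweep (X l) (X (Suc l)))"
proof -
  have "\<exists>X. \<forall>l. (adm (X l) \<and> (l = 0 \<longrightarrow> X l = x0)) \<and> sweep (X l) (X (Suc l))"
    using assms by (intro dependent_nat_choice) (use sweep_exists sweep_adm in fastforce)+
  then show ?thesis by blast
qed

text \<open>The outer sequences have limits that are sub- and supersolutions at once, so
  \<open>sub_le_super\<close>, applied both ways, identifies them. The same comparison makes the
  limit independent of the sequence, which is why \<open>w\<close> comes before \<open>X\<close> in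
  the quantifiers.\<close>

theorem sweep_convergence:
  assumes "adm x0"
  shows "\<exists>w. adm w \<and> super w \<and> sub w \<and>
    (\<forall>X. adm (X 0) \<longrightarrow> (\<forall>l. sweep (X l) (X (Suc l))) \<longrightarrow> (\<forall>j\<in>{1..n}. (\<lambda>l. X l j) \<longlonglongrightarrow> w j))"
proof -
  have sandwich: "\<exists>w. adm w \<and> super w \<and> sub w \<and> (\<forall>j\<in>{1..n}. (\<lambda>l. X l j) \<longlonglongrightarrow> w j)"
    if X: "adm (X 0)" "\<And>l. sweep (X l) (X (Suc l))" for X
  proof -
    obtain u where u: "adm u" "super u" "\<And>j. j \<in> {1..n} \<Longrightarrow> X 0 j \<le> u j"
      using super_exists [OF X(1)] by auto
    obtain v where v: "adm v" "sub v" "\<And>j. j \<in> {1..n} \<Longrightarrow> v j \<le> X 0 j"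
      using sub_exists [OF X(1)] by auto
    obtain U where U: "U 0 = u" "\<And>l. sweep (U l) (U (Suc l))"
      using sweep_sequence_exists [OF u(1)] by auto
    obtain V where V: "V 0 = v" "\<And>l. sweep (V l) (V (Suc l))"
      using sweep_sequence_exists [OF v(1)] by auto
    obtain w where w: "adm w" "super w" "sub w" "\<And>j. j \<in> {1..n} \<Longrightarrow> (\<lambda>l. U l j) \<longlonglongrightarrow> w j"
      using super_limit [of U v] U u v by auto
    obtain w' where w': "adm w'" "super w'" "sub w'" "\<And>j. j \<in> {1..n} \<Longrightarrow> (\<lambda>l. V l j) \<longlonglongrightarrow> w' j"
      using sub_limit [of V u] V u v by auto
    have eq: "w' j = w j" if "j \<in> {1..n}" for j
      using sub_le_super w w' that by (intro antisym) auto
    have up: "\<forall>j\<in>{1..n}. X l j \<le> U l j" for l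
    proof (induction l)
      case (Suc l)
      then show ?case using sweep_mono [OF X(2) U(2)] by blast
    qed (use U u in auto)
    have down: "\<forall>j\<in>{1..n}. V l j \<le> X l j" for l
    proof (induction l)
      case (Suc l)
      then show ?case using sweep_mono [OF V(2) X(2)] by blast
    qed (use V v in auto)
    have "(\<lambda>l. X l j) \<longlonglongrightarrow> w j" if "j \<in> {1..n}" for j
    proof (rule tendsto_sandwich)
      show "(\<lambda>l. V l j) \<longlonglongrightarrow> w j" using w'(4) [OF that] by (simp only: eq [OF that])
      show "(\<lambda>l. U l j) \<longlonglongrightarrow> w j" by (rule w(4) [OF that])
      show "\<forall>\<^sub>F l in sequentially. V l j \<le> X l j"
        by (intro always_eventually allI bspec [OF down that])
      show "\<forall>\<^sub>F l in sequentially. X l j \<le> U l j"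
        by (intro always_eventually allI bspec [OF up that])
    qed
    then show ?thesis using w by blast
  qed
  obtain X where "X 0 = x0" "\<And>l. sweep (X l) (X (Suc l))"
    using sweep_sequence_exists [OF assms] by auto
  then obtain w where w: "adm w" "super w" "sub w"
    using sandwich [of X] assms by auto
  have "(\<lambda>l. X l j) \<longlonglongrightarrow> w j"
    if X: "adm (X 0)" "\<And>l. sweep (X l) (X (Suc l))" and j: "j \<in> {1..n}" for X j
  proof -
    obtain w' where w': "adm w'" "super w'" "sub w'" "\<And>j. j \<in> {1..n} \<Longrightarrow> (\<lambda>l. X l j) \<longlonglongrightarrow> w' j"
      using sandwich [OF X] by auto
    have "w' j = w j"
      using sub_le_super w w' j by (intro antisym) auto
    then show ?thesis using w'(4) [OF j] by simp
  qed
  with w show ?thesis by blast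
qed

end

section \<open>Energy\<close>

abbreviation pair_potential :: "real \<Rightarrow> real \<Rightarrow> real" where
  "pair_potential h \<equiv> charge_potential h 0"

lemma charge_potential_diff: "charge_potential h x y = pair_potential h (y - x)"
  by (simp add: charge_potential_def)

lemma pair_potential_minus: "pair_potential h (- d) = pair_potential h d"
proof -
  have "(- d + h) * (- d - h) = (d + h) * (d - h)"
    by (simp add: algebra_simps)
  moreover have "pair_potential h s = - s * pair_force h s - 1 / 2 * ln ((s + h) * (s - h))" for s
    by (simp add: charge_potential_def charge_force_def)
  ultimately show ?thesis by simp
qed

lemma pair_potential_deriv:
  assumes "0 < h" "h < d"
  shows "(pair_potential h has_real_derivative - pair_force h d) (at d)"
proof -
  have "0 < (d + h) / (d - h)" "0 < (d + h) * (d - h)"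
    using assms by auto
  note pos = this
  show ?thesis
    unfolding charge_potential_def [abs_def] charge_force_def
    by (insert pos assms, (rule derivative_eq_intros refl | simp)+)
qed

text \<open>The tangent inequality of a convex function, requiring monotonicity only between the two
  points: a pair potential must not be followed across the band.\<close>

lemma above_tangent_if_antimono:
  fixes F f :: "real \<Rightarrow> real"
  assumes "\<And>z. \<lbrakk>min x y \<le> z; z \<le> max x y\<rbrakk> \<Longrightarrow> (F has_real_derivative - f z) (at z)"
    and "\<And>z w. \<lbrakk>min x y \<le> z; z \<le> w; w \<le> max x y\<rbrakk> \<Longrightarrow> f w \<le> f z"
  shows "F x - f x * (y - x) \<le> F y"
proof (cases x y rule: linorder_cases)
  case less
  then obtain z where z: "x < z" "z < y" "F y - F x = (y - x) * - f z"
    using MVT2 [of x y F "\<lambda>z. - f z"] assms(1) by auto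
  then have "(y - x) * f z \<le> (y - x) * f x"
    using less by (intro mult_left_mono assms(2)) auto
  then show ?thesis using z(3) by (simp add: algebra_simps)
next
  case greater
  then obtain z where z: "y < z" "z < x" "F x - F y = (x - y) * - f z"
    using MVT2 [of y x F "\<lambda>z. - f z"] assms(1) by auto
  then have "(x - y) * f x \<le> (x - y) * f z"
    using greater by (intro mult_left_mono assms(2)) auto
  then show ?thesis using z(3) by (simp add: algebra_simps)
qed simp

lemma pair_potential_above_tangent:
  assumes "0 < h" "h < d \<and> h < e \<or> d < - h \<and> e < - h"
  shows "pair_potential h d - pair_force h d * (e - d) \<le> pair_potential h e"
proof -
  have pos: "pair_potential h d - pair_force h d * (e - d) \<le> pair_potential h e" if "h < d" "h < e" for d e
    using assms(1) that
    by (intro above_tangent_if_antimono pair_potential_deriv pair_force_antimono) auto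
  show ?thesis
    using assms(2) pos [of d e] pos [of "- d" "- e"]
    by (auto simp: pair_potential_minus algebra_simps)
qed

text \<open>The right-hand side depends on the set of positions alone, so relabelling the charges
  does not change the energy.\<close>

lemma energy_image:
  assumes "inj_on w {1..n}"
  shows "energy h \<phi> n w = (\<Sum>s\<in>w ` {1..n}. \<Sum>t\<in>w ` {1..n} - {s}. charge_potential h t s) +
    2 * (\<Sum>s\<in>w ` {1..n}. \<phi> s)"
proof -
  have "(\<Sum>t\<in>w ` {1..n} - {w j}. charge_potential h t (w j)) = (\<Sum>k\<in>{1..n} - {j}. charge_potential h (w k) (w j))"
    if "j \<in> {1..n}" for j
  proof -
    have "w ` {1..n} - {w j} = w ` ({1..n} - {j})"
      using inj_on_image_set_diff [OF assms, of "{1..n}" "{j}"] that by simp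
    then show ?thesis
      using inj_on_subset [OF assms] by (simp add: sum.reindex)
  qed
  then show ?thesis
    unfolding energy_def using assms by (simp add: sum.reindex)
qed

lemma sorted_rearrangement:
  fixes y :: "nat \<Rightarrow> real"
  assumes "0 \<le> h" "\<And>j. j \<in> {1..n} \<Longrightarrow> y j \<in> einterval a b"
    and sep: "\<And>j k. \<lbrakk>j \<in> {1..n}; k \<in> {1..n}; j \<noteq> k\<rbrakk> \<Longrightarrow> h < \<bar>y j - y k\<bar>"
  obtains z where "admissible h a b n z" "energy h \<phi> n z = energy h \<phi> n y"
proof
  define Y where "Y = y ` {1..n}"
  define z where "z = (\<lambda>j. sorted_list_of_set Y ! (j - 1))"
  have inj: "inj_on y {1..n}"
  proof (rule inj_onI, rule ccontr)
    fix j k assume "j \<in> {1..n}" "k \<in> {1..n}" "y j = y k" "j \<noteq> k"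
    then show False using sep [of j k] assms(1) by simp
  qed
  have fin: "finite Y" by (simp add: Y_def)
  have card: "card Y = n" using card_image [OF inj] by (simp add: Y_def)
  have len: "length (sorted_list_of_set Y) = n" using card by simp
  have less: "z i < z j" if "1 \<le> i" "i < j" "j \<le> n" for i j
    using that len sorted_wrt_nth_less [OF strict_sorted_list_of_set [of Y], of "i - 1" "j - 1"]
    by (simp add: z_def)
  have zY: "z j \<in> Y" if "j \<in> {1..n}" for j
  proof -
    have "j - 1 < length (sorted_list_of_set Y)" using that len by auto
    then have "z j \<in> set (sorted_list_of_set Y)" unfolding z_def by (rule nth_mem)
    then show ?thesis using fin by simp
  qed
  have injz: "inj_on z {1..n}"
    by (rule linorder_inj_onI) (use less in force)+
  then have "z ` {1..n} = Y"
    using zY fin card by (intro card_subset_eq) (auto simp: card_image)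
  then show "energy h \<phi> n z = energy h \<phi> n y"
    by (simp add: energy_image [OF injz] energy_image [OF inj] Y_def)
  have gap: "z i + h < z j" if ij: "1 \<le> i" "i < j" "j \<le> n" for i j
  proof -
    obtain k l where kl: "k \<in> {1..n}" "l \<in> {1..n}" "z i = y k" "z j = y l"
      using zY [of i] zY [of j] ij by (auto simp: Y_def)
    then show ?thesis
      using sep [of l k] less [OF ij] by (cases "k = l") auto
  qed
  moreover have "z j \<in> einterval a b" if "j \<in> {1..n}" for j
    using zY [OF that] assms(2) by (auto simp: Y_def)
  ultimately show "admissible h a b n z"
    using assms(1) by (simp add: admissible_iff)
qed

section \<open>Minimality of critical distributions, and the method as a sequence of sweeps\<close>

context charge_field
begin

text \<open>Add the tangent inequalities at \<open>x\<close> of all pair terms, whose charges stand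
  in the same order in \<open>x\<close> and \<open>y\<close>, and of the field terms. The linear
  parts form the derivative of the energy at \<open>x\<close> in direction \<open>D\<close>, a
  combination of the net forces, and vanish.\<close>

lemma critical_energy_le:
  assumes \<phi>: "\<And>s. s \<in> I \<Longrightarrow> (\<phi> has_real_derivative - g s) (at s)"
    and x: "adm x" "\<And>j. j \<in> {1..n} \<Longrightarrow> net_force (others j) x (x j) = 0"
    and y: "adm y"
  shows "energy h \<phi> n x \<le> energy h \<phi> n y"
proof -
  define D where "D = (\<lambda>j. y j - x j)"
  define c where "c = (\<lambda>j k. pair_force h (x j - x k))"
  have anti: "c j k = - c k j" for j k
    using pair_force_minus [of h "x j - x k"] by (simp add: c_def)
  have pot: "charge_potential h (x k) (x j) - c j k * (D j - D k) \<le> charge_potential h (y k) (y j)"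
    if "j \<in> {1..n}" "k \<in> others j" for j k
  proof -
    have "(h < x j - x k \<and> h < y j - y k) \<or> (x j - x k < - h \<and> y j - y k < - h)"
      using that admD(2) [OF x(1), of j k] admD(2) [OF x(1), of k j]
        admD(2) [OF y, of j k] admD(2) [OF y, of k j]
      by (cases "k < j") auto
    from pair_potential_above_tangent [OF h_pos this] show ?thesis
      by (simp add: charge_potential_diff [of h "x k"] charge_potential_diff [of h "y k"] c_def D_def algebra_simps)
  qed
  have field: "\<phi> (x j) - g (x j) * D j \<le> \<phi> (y j)" if "j \<in> {1..n}" for j
    unfolding D_def
  proof (rule above_tangent_if_antimono)
    have I: "z \<in> I" if "min (x j) (y j) \<le> z" "z \<le> max (x j) (y j)" for z
      using that admD(1) [OF x(1) \<open>j \<in> {1..n}\<close>] admD(1) [OF y \<open>j \<in> {1..n}\<close>]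
        einterval_between [of "min (x j) (y j)" a b "max (x j) (y j)" z]
      by (simp add: min_def max_def split: if_splits)
    show "(\<phi> has_real_derivative - g z) (at z)" if "min (x j) (y j) \<le> z" "z \<le> max (x j) (y j)" for z
      using \<phi> I that by blast
    show "g w \<le> g z" if "min (x j) (y j) \<le> z" "z \<le> w" "w \<le> max (x j) (y j)" for z w
      using that I [of z] I [of w] by (intro g_mono) auto
  qed
  \<comment> \<open>Antisymmetry of \<open>c\<close> turns the half with \<open>D k\<close> into a
    second copy of the half with \<open>D j\<close>.\<close>
  have "(\<Sum>j\<in>{1..n}. \<Sum>k\<in>{1..n}. c j k * D k) = (\<Sum>j\<in>{1..n}. \<Sum>k\<in>{1..n}. c k j * D j)"
    by (rule sum.swap)
  also have "\<dots> = - (\<Sum>j\<in>{1..n}. \<Sum>k\<in>{1..n}. c j k * D j)"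
    unfolding sum_negf [symmetric] by (intro sum.cong refl) (subst anti, simp)
  finally have "(\<Sum>j\<in>{1..n}. \<Sum>k\<in>{1..n}. c j k * (D j - D k)) = 2 * (\<Sum>j\<in>{1..n}. D j * (\<Sum>k\<in>{1..n}. c j k))"
    by (simp add: right_diff_distrib sum_subtractf sum_distrib_left mult.commute)
  moreover have all: "(\<Sum>k\<in>others j. f k) = (\<Sum>k\<in>{1..n}. f k)" if "f j = 0" for f :: "nat \<Rightarrow> real" and j
    using that by (intro sum.mono_neutral_left) auto
  have "(\<Sum>k\<in>{1..n}. c j k) = - g (x j)" if "j \<in> {1..n}" for j
    using x(2) [OF that] all [of "c j" j] by (simp add: net_force_def charge_force_diff [of h "x _"] c_def)
  ultimately have zero: "(\<Sum>j\<in>{1..n}. \<Sum>k\<in>{1..n}. c j k * (D j - D k)) = - 2 * (\<Sum>j\<in>{1..n}. g (x j) * D j)"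
    by (simp add: sum_negf mult.commute)
  have "energy h \<phi> n x = energy h \<phi> n x - (\<Sum>j\<in>{1..n}. \<Sum>k\<in>others j. c j k * (D j - D k)) - 2 * (\<Sum>j\<in>{1..n}. g (x j) * D j)"
  proof -
    have "(\<Sum>k\<in>others j. c j k * (D j - D k)) = (\<Sum>k\<in>{1..n}. c j k * (D j - D k))" for j
      by (rule all) simp
    then show ?thesis using zero by simp
  qed
  also have "\<dots> = (\<Sum>j\<in>{1..n}. \<Sum>k\<in>others j. charge_potential h (x k) (x j) - c j k * (D j - D k)) +
      2 * (\<Sum>j\<in>{1..n}. \<phi> (x j) - g (x j) * D j)"
    by (simp add: energy_def sum_subtractf)
  also have "\<dots> \<le> energy h \<phi> n y"
    unfolding energy_def using pot field by (intro add_mono sum_mono mult_left_mono) auto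
  finally show ?thesis .
qed

text \<open>Both points lie on the same side of each charge, so no band separates them and the net
  force strictly decreases from one to the other.\<close>

lemma balance_point_unique:
  assumes "finite K" "s \<in> I" "t \<in> I" "net_force K z s = 0" "net_force K z t = 0"
    and "\<And>k. k \<in> K \<Longrightarrow> z k + h < s \<and> z k + h < t \<or> s + h < z k \<and> t + h < z k"
  shows "s = t"
proof (rule ccontr)
  have no: False if "s < t" "s \<in> I" "t \<in> I" "net_force K z s = 0" "net_force K z t = 0"
      "\<And>k. k \<in> K \<Longrightarrow> z k + h < s \<or> t + h < z k" for s t
  proof -
    have "net_force K z t < net_force K z s"
      using that(1-3) by (intro net_force_less [OF assms(1)]) (use that(6) in force)+
    then show False using that by simp
  qed
  assume "s \<noteq> t"
  then show False
    using no [of s t] no [of t s] assms by (cases "s < t") (auto; blast)+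
qed

lemma iedm_solution_net_force:
  assumes "g = field_force \<phi>" "j \<in> {1..n}"
  shows "iedm_solution h a b \<phi> n X l j t \<longleftrightarrow>
    t \<in> I \<and> (1 < j \<longrightarrow> X (Suc l) (j - 1) + h < t) \<and> (j < n \<longrightarrow> t + h < X l (Suc j)) \<and>
    net_force (others j) (mixed j (X (Suc l)) (X l)) t = 0"
proof -
  have split: "others j = {1..<j} \<union> {j<..n}" using assms(2) by auto
  have "(\<Sum>k\<in>others j. charge_force h (mixed j (X (Suc l)) (X l) k) t) =
      (\<Sum>k\<in>{1..<j}. charge_force h (mixed j (X (Suc l)) (X l) k) t) +
      (\<Sum>k\<in>{j<..n}. charge_force h (mixed j (X (Suc l)) (X l) k) t)"
    unfolding split by (rule sum.union_disjoint) auto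
  also have "\<dots> = (\<Sum>k\<in>{1..<j}. charge_force h (X (Suc l) k) t) + (\<Sum>k\<in>{j<..n}. charge_force h (X l k) t)"
    by (simp add: mixed_def)
  finally have net: "net_force (others j) (mixed j (X (Suc l)) (X l)) t =
      (\<Sum>k\<in>{1..<j}. charge_force h (X (Suc l) k) t) + (\<Sum>k\<in>{j<..n}. charge_force h (X l k) t) + g t"
    by (simp only: net_force_def)
  show ?thesis
    unfolding iedm_solution_def net assms(1) [symmetric] by (auto simp: less_diff_eq)
qed

lemma iedm_iterates_sweep:
  assumes g: "g = field_force \<phi>" and "adm x0" and X: "iedm_iterates h a b \<phi> n x0 X"
  shows "adm (X l)" "sweep (X l) (X (Suc l))"
proof -
  have sol: "iedm_solution h a b \<phi> n X l j (X (Suc l) j)" if "j \<in> {1..n}" for j l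
    using X that by (simp add: iedm_iterates_def)
  note sol = sol [THEN iedm_solution_net_force [OF g, THEN iffD1, rotated]]
  have "adm (X (Suc l))" for l
  proof (rule admissible_if_neighbours)
    show "X (Suc l) j + h < X (Suc l) (Suc j)" if "1 \<le> j" "j < n" for j
      using sol [of "Suc j" l] that by simp
  qed (use sol h_pos in auto)
  moreover have "adm (X 0)"
    using assms(2) X by (simp add: adm_iff iedm_iterates_def)
  ultimately have adm: "adm (X l)" for l
    by (cases l) auto
  show "adm (X l)" by (rule adm)
  show "sweep (X l) (X (Suc l))"
    unfolding sweep_def swept_def
  proof (intro ballI conjI allI impI)
    fix j assume j: "j \<in> {1..n}"
    show "X (Suc l) j \<in> I" "net_force (others j) (mixed j (X (Suc l)) (X l)) (X (Suc l) j) = 0"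
      using sol [OF j j] by auto
    show "X (Suc l) k + h < X (Suc l) j" if "1 \<le> k" "k < j" for k
      using admD(2) [OF adm that] j by simp
    show "X (Suc l) j + h < X l k" if "j < k" "k \<le> n" for k
    proof -
      have "X (Suc l) j + h < X l (Suc j)" using sol [OF j j, of l] that by auto
      moreover have "X l (Suc j) \<le> X l k"
        using admD(2) [OF adm, of "Suc j" k l] that h_pos by (cases "Suc j = k") auto
      ultimately show ?thesis by simp
    qed
  qed
qed

text \<open>The method also demands uniqueness of each solution. A candidate is only known to clear
  its neighbours; admissibility of both stages extends this to all charges, as
  \<open>balance_point_unique\<close> requires.\<close>

lemma sweep_iedm_iterates:
  assumes g: "g = field_force \<phi>" and X: "\<And>l. adm (X l)" "\<And>l. sweep (X l) (X (Suc l))"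
  shows "iedm_iterates h a b \<phi> n (X 0) X"
  unfolding iedm_iterates_def
proof (intro conjI ballI allI impI)
  fix l j assume j: "j \<in> {1..n}"
  note iff = iedm_solution_net_force [OF g j]
  have "1 < j \<longrightarrow> X (Suc l) (j - 1) + h < X (Suc l) j"
    using admD(2) [OF X(1), of "j - 1" j "Suc l"] j by auto
  moreover have "j < n \<longrightarrow> X (Suc l) j + h < X l (Suc j)"
    using sweepD(1) [OF X(2), of j "Suc j" l] j by auto
  ultimately have "iedm_solution h a b \<phi> n X l j (X (Suc l) j)"
    unfolding iff using sweepD(2) [OF X(2) j] admD(1) [OF X(1) j] by blast
  then show sol: "iedm_solution h a b \<phi> n X l j (X (l + 1) j)" by simp
  have gap: "k < j \<Longrightarrow> mixed j (X (Suc l)) (X l) k + h < t" "j < k \<Longrightarrow> t + h < mixed j (X (Suc l)) (X l) k"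
    if t: "iedm_solution h a b \<phi> n X l j t" and k: "k \<in> others j" for t k
  proof -
    have "X (Suc l) k + h < t" if "k < j"
    proof -
      have "X (Suc l) (j - 1) + h < t" using t j that k unfolding iff by auto
      moreover have "X (Suc l) k \<le> X (Suc l) (j - 1)"
      proof (cases "k = j - 1")
        case False
        then have "1 \<le> k" "k < j - 1" "j - 1 \<le> n" using j k that by auto
        from admD(2) [OF X(1) this] show ?thesis using h_pos by (smt (verit))
      qed simp
      ultimately show ?thesis by simp
    qed
    then show "k < j \<Longrightarrow> mixed j (X (Suc l)) (X l) k + h < t" by (simp add: mixed_def)
    have "t + h < X l k" if "j < k"
    proof -
      have "t + h < X l (Suc j)" using t j that k unfolding iff by auto
      moreover have "X l (Suc j) \<le> X l k"
        using admD(2) [OF X(1), of "Suc j" k l] k that h_pos by (cases "Suc j = k") auto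
      ultimately show ?thesis by simp
    qed
    then show "j < k \<Longrightarrow> t + h < mixed j (X (Suc l)) (X l) k" by (simp add: mixed_def)
  qed
  fix t assume t: "iedm_solution h a b \<phi> n X l j t"
  show "t = X (l + 1) j"
  proof (rule balance_point_unique [where z = "mixed j (X (Suc l)) (X l)"])
    fix k assume k: "k \<in> others j"
    show "mixed j (X (Suc l)) (X l) k + h < t \<and> mixed j (X (Suc l)) (X l) k + h < X (l + 1) j \<or>
        t + h < mixed j (X (Suc l)) (X l) k \<and> X (l + 1) j + h < mixed j (X (Suc l)) (X l) k"
      using gap [OF t k] gap [OF sol k] k by (cases "k < j") auto
  next
    show "finite (others j)" by simp
  qed (use t sol in \<open>simp_all only: iff\<close>)
qed simp

lemma admissible_exists:
  assumes "\<And>a' b'. \<lbrakk>a = ereal a'; b = ereal b'\<rbrakk> \<Longrightarrow> (real n - 1) * h < b' - a'"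
  shows "\<exists>x. adm x"
proof -
  obtain p where p: "p \<in> I" using left_pos by blast
  have "\<exists>x. (\<forall>j\<in>{1..n}. x j \<in> I) \<and> (\<forall>j. x j + h < x (Suc j))"
  proof (cases "b = \<infinity>")
    case True
    have "p + 2 * h * real j \<in> I" for j
    proof -
      have "ereal p \<le> ereal (p + 2 * h * real j)" using h_pos by simp
      then show ?thesis
        using p True less_le_trans [of a "ereal p"] by (simp add: einterval_iff)
    qed
    then show ?thesis
      using h_pos by (intro exI [of _ "\<lambda>j. p + 2 * h * real j"]) (auto simp: algebra_simps)
  next
    case b: False
    then obtain b' where b': "b = ereal b'" using p by (cases b) (auto simp: einterval_iff)
    show ?thesis
    proof (cases "a = - \<infinity>")
      case True
      have "p - 2 * h * (real n - real j) \<in> I" if "j \<in> {1..n}" for j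
      proof -
        have "ereal (p - 2 * h * (real n - real j)) \<le> ereal p" using h_pos that by simp
        then show ?thesis
          using p True le_less_trans [of _ "ereal p" b] by (simp add: einterval_iff)
      qed
      then show ?thesis
        using h_pos by (intro exI [of _ "\<lambda>j. p - 2 * h * (real n - real j)"]) (auto simp: algebra_simps)
    next
      case False
      then obtain a' where a': "a = ereal a'" using p by (cases a) (auto simp: einterval_iff)
      \<comment> \<open>The slack is split into \<open>n + 1\<close> equal parts: one for each of
        the \<open>n - 1\<close> gaps and one at each end.\<close>
      define \<epsilon> where "\<epsilon> = (b' - a' - (real n - 1) * h) / (real n + 1)"
      have \<epsilon>: "0 < \<epsilon>" "(real n + 1) * \<epsilon> = b' - a' - (real n - 1) * h"
        using assms [OF a' b'] by (auto simp: \<epsilon>_def)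
      define x where "x = (\<lambda>j. a' + (real j - 1) * h + real j * \<epsilon>)"
      have "a' < x j \<and> x j < b'" if "j \<in> {1..n}" for j
      proof -
        have "0 \<le> (real j - 1) * h" "(real j - 1) * h \<le> (real n - 1) * h"
            "0 < real j * \<epsilon>" "real j * \<epsilon> < (real n + 1) * \<epsilon>"
          using that h_pos \<epsilon>(1) by (auto intro!: mult_right_mono mult_strict_right_mono)
        then show ?thesis using \<epsilon>(2) by (simp add: x_def)
      qed
      moreover have "x j + h < x (Suc j)" for j
        using \<epsilon>(1) by (simp add: x_def algebra_simps)
      ultimately show ?thesis
        using a' b' by (intro exI [of _ x]) (auto simp: einterval_iff)
    qed
  qed
  then show ?thesis
    using admissible_if_neighbours h_pos by (metis less_imp_le)
qed

end

section \<open>G-convex fields\<close>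

text \<open>A bound \<open>K\<close> would give
  \<open>\<bar>B\<bar> \<le> (K + 1) * \<bar>A\<bar>\<close> near \<open>a\<close>. Multiplied out,
  this extends to \<open>a\<close> by continuity and makes \<open>a\<close> a common root, against
  coprimality.\<close>

lemma exceeds_near_left_pole:
  fixes A B :: "real poly"
  assumes "coprime A B" "poly A a = 0" "a < p"
    and pos: "\<And>x. \<lbrakk>a < x; x \<le> p\<rbrakk> \<Longrightarrow> poly A x \<noteq> 0 \<and> 0 < 1 + poly B x / poly A x"
  shows "\<exists>x. a < x \<and> x \<le> p \<and> K < 1 + poly B x / poly A x"
proof (rule ccontr)
  assume "\<not> ?thesis"
  then have le: "1 + poly B x / poly A x \<le> K" if "a < x" "x \<le> p" for x
    using that by force
  have bound: "\<bar>poly B x\<bar> \<le> (K + 1) * \<bar>poly A x\<bar>" if "a < x" "x \<le> p" for x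
  proof -
    have "\<bar>poly B x / poly A x\<bar> \<le> K + 1"
      using le [OF that] pos [OF that] by (simp add: abs_le_iff) linarith
    then show ?thesis
      using pos [OF that] by (simp add: abs_divide pos_divide_le_eq)
  qed
  have "eventually (\<lambda>x. \<bar>poly B x\<bar> \<le> (K + 1) * \<bar>poly A x\<bar>) (at_right a)"
    unfolding eventually_at_right [OF assms(3)] using bound assms(3) by (intro exI [of _ p]) auto
  moreover have "((\<lambda>x. \<bar>poly B x\<bar>) \<longlongrightarrow> \<bar>poly B a\<bar>) (at_right a)"
      "((\<lambda>x. (K + 1) * \<bar>poly A x\<bar>) \<longlongrightarrow> (K + 1) * \<bar>poly A a\<bar>) (at_right a)"
    by (intro tendsto_intros)+
  ultimately have "\<bar>poly B a\<bar> \<le> (K + 1) * \<bar>poly A a\<bar>"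
    by (intro tendsto_le [OF trivial_limit_at_right_real])
  then show False
    using coprime_poly_0 [OF assms(1), of a] assms(2) by simp
qed

text \<open>A positive lower bound \<open>K\<close> would give
  \<open>K * \<bar>A\<bar> \<le> \<bar>A + B\<bar>\<close> up to \<open>b\<close>, so
  \<open>A\<close> and then \<open>B\<close> would vanish there.\<close>

lemma undercuts_near_right_zero:
  fixes A B :: "real poly"
  assumes "coprime A B" "poly (A + B) b = 0" "p < b" "0 < K"
    and pos: "\<And>x. \<lbrakk>p \<le> x; x < b\<rbrakk> \<Longrightarrow> poly A x \<noteq> 0 \<and> 0 < 1 + poly B x / poly A x"
  shows "\<exists>x. p \<le> x \<and> x < b \<and> 1 + poly B x / poly A x < K"
proof (rule ccontr)
  assume "\<not> ?thesis"
  then have ge: "K \<le> 1 + poly B x / poly A x" if "p \<le> x" "x < b" for x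
    using that by force
  have bound: "K * \<bar>poly A x\<bar> \<le> \<bar>poly (A + B) x\<bar>" if "p \<le> x" "x < b" for x
  proof -
    have "poly (A + B) x = (1 + poly B x / poly A x) * poly A x"
      using pos [OF that] by (simp add: field_simps)
    then have "\<bar>poly (A + B) x\<bar> = (1 + poly B x / poly A x) * \<bar>poly A x\<bar>"
      using pos [OF that] by (simp only: abs_mult abs_of_pos)
    then show ?thesis
      using ge [OF that] by (simp only: mult_right_mono abs_ge_zero)
  qed
  have "eventually (\<lambda>x. K * \<bar>poly A x\<bar> \<le> \<bar>poly (A + B) x\<bar>) (at_left b)"
    unfolding eventually_at_left [OF assms(3)] using bound assms(3) by (intro exI [of _ p]) auto
  moreover have "((\<lambda>x. \<bar>poly (A + B) x\<bar>) \<longlongrightarrow> \<bar>poly (A + B) b\<bar>) (at_left b)"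
      "((\<lambda>x. K * \<bar>poly A x\<bar>) \<longlongrightarrow> K * \<bar>poly A b\<bar>) (at_left b)"
    by (intro tendsto_intros)+
  ultimately have "K * \<bar>poly A b\<bar> \<le> \<bar>poly (A + B) b\<bar>"
    by (intro tendsto_le [OF trivial_limit_at_left_real])
  then have "poly A b = 0" using assms(2,4) by (simp add: mult_le_0_iff)
  then show False
    using coprime_poly_0 [OF assms(1), of b] assms(2) by simp
qed

lemma G_convex_charge_field:
  assumes "0 < h" "a < b" and G: "G_convex h a b A B \<phi>"
  shows "charge_field h a b (field_force \<phi>)"
    and "\<And>x. x \<in> einterval a b \<Longrightarrow> (\<phi> has_real_derivative - field_force \<phi> x) (at x)"
proof -
  define f where "f = (\<lambda>x. 1 + poly B x / poly A x)"
  have cop: "coprime A B" and pos: "\<And>x. x \<in> einterval a b \<Longrightarrow> poly A x \<noteq> 0 \<and> 0 < f x"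
    and deriv: "\<And>x. x \<in> einterval a b \<Longrightarrow> (\<phi> has_real_derivative - (1 / (2 * h) * ln (f x))) (at x)"
    using G by (auto simp: G_convex_def external_field_def f_def)
  have anti: "f y \<le> f x" if "x \<in> einterval a b" "y \<in> einterval a b" "x \<le> y" for x y
    using G that unfolding G_convex_def f_def by (blast dest: monotone_onD)
  have force: "field_force \<phi> x = 1 / (2 * h) * ln (f x)" if "x \<in> einterval a b" for x
    using DERIV_imp_deriv [OF deriv [OF that]] by (simp add: field_force_def)
  show "(\<phi> has_real_derivative - field_force \<phi> x) (at x)" if "x \<in> einterval a b" for x
    using deriv [OF that] by (simp only: force [OF that])
  obtain p where p: "a < ereal p" "ereal p < b"
    using ereal_dense2 [OF assms(2)] by blast
  have above: "\<exists>x\<in>einterval a b. K < f x" if finite: "a \<noteq> - \<infinity>" for K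
  proof -
    obtain a' where a': "a = ereal a'" using finite p(1) by (cases a) auto
    have I: "x \<in> einterval a b" if "a' < x" "x \<le> p" for x
      using that a' p le_less_trans [of "ereal x" "ereal p" b] by (simp add: einterval_iff)
    have "poly A a' = 0" using G a' by (simp add: G_convex_def)
    then have "\<exists>x. a' < x \<and> x \<le> p \<and> K < 1 + poly B x / poly A x"
      using cop p(1) a' pos I by (intro exceeds_near_left_pole) (auto simp: f_def)
    then show ?thesis using I by (auto simp: f_def)
  qed
  have below: "\<exists>x\<in>einterval a b. f x < K" if finite: "b \<noteq> \<infinity>" and K: "0 < K" for K
  proof -
    obtain b' where b': "b = ereal b'" using finite p(2) by (cases b) auto
    have I: "x \<in> einterval a b" if "p \<le> x" "x < b'" for x
      using that b' p less_le_trans [of a "ereal p" "ereal x"] by (simp add: einterval_iff)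
    have "poly (A + B) b' = 0" using G b' by (simp add: G_convex_def)
    then have "\<exists>x. p \<le> x \<and> x < b' \<and> 1 + poly B x / poly A x < K"
      using cop p(2) b' pos I K by (intro undercuts_near_right_zero) (auto simp: f_def)
    then show ?thesis using I by (auto simp: f_def)
  qed
  \<comment> \<open>The value 1 of \<open>f\<close> corresponds to zero force, as
    \<open>ln 1 = 0\<close>.\<close>
  have gt1: "\<exists>x\<in>einterval a b. 1 < f x"
  proof (cases "a = - \<infinity>")
    case True
    then obtain L where "1 < L" "((\<lambda>x. ereal (f x)) \<longlongrightarrow> L) at_bot"
      using G by (auto simp: G_convex_def f_def)
    then have "eventually (\<lambda>x. 1 < ereal (f x)) at_bot"
      by (intro order_tendstoD)
    then have "eventually (\<lambda>x. 1 < ereal (f x) \<and> x \<le> p) at_bot"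
      by (intro eventually_conj eventually_le_at_bot)
    then obtain x where "1 < f x" "x \<le> p"
      using eventually_happens' [OF trivial_limit_at_bot_linorder] by fastforce
    then show ?thesis
      using True p le_less_trans [of "ereal x" "ereal p" b] by (intro bexI [of _ x]) (auto simp: einterval_iff)
  qed (use above in blast)
  have lt1: "\<exists>x\<in>einterval a b. f x < 1"
  proof (cases "b = \<infinity>")
    case True
    then obtain L where "L < 1" "(f \<longlongrightarrow> L) at_top"
      using G by (auto simp: G_convex_def f_def)
    then have "eventually (\<lambda>x. f x < 1) at_top"
      by (intro order_tendstoD)
    then have "eventually (\<lambda>x. f x < 1 \<and> p \<le> x) at_top"
      by (intro eventually_conj eventually_ge_at_top)
    then obtain x where "f x < 1" "p \<le> x"
      using eventually_happens' [OF trivial_limit_at_top_linorder] by fastforce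
    then show ?thesis
      using True p less_le_trans [of a "ereal p" "ereal x"] by (intro bexI [of _ x]) (auto simp: einterval_iff)
  qed (use below in auto)
  \<comment> \<open>G-convexity supplies weak monotonicity. On a flat piece the polynomial
    \<open>q\<close> has infinitely many roots, so \<open>f\<close> is constant throughout, against
    \<open>gt1\<close> and \<open>lt1\<close>.\<close>
  have strict: "f y < f x" if xy: "x \<in> einterval a b" "y \<in> einterval a b" "x < y" for x y
  proof (rule ccontr)
    assume "\<not> f y < f x"
    then have eq: "f z = f x" if "z \<in> {x..y}" for z
      using that xy anti [of x z] anti [of z y] einterval_between [of x a b y z] by auto
    define q where "q = A + B - smult (f x) A"
    have "poly q z = 0" if "z \<in> {x..y}" for z
      using eq [OF that] pos [of z] that xy einterval_between [of x a b y z]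
      by (auto simp: q_def f_def field_simps)
    then have "{x..y} \<subseteq> {z. poly q z = 0}" by blast
    then have "infinite {z. poly q z = 0}"
      using infinite_Icc [OF xy(3)] finite_subset by blast
    then have "q = 0" using poly_roots_finite by blast
    then have "poly (A + B - smult (f x) A) z = 0" for z by (simp only: q_def poly_0)
    then have zero: "poly A z + poly B z - f x * poly A z = 0" for z by simp
    have "f z = f x" if "z \<in> einterval a b" for z
    proof -
      have "f z * poly A z = f x * poly A z"
        using zero [of z] pos [OF that] by (simp add: f_def algebra_simps)
      then show ?thesis using pos [OF that] by simp
    qed
    then show False using gt1 lt1 by force
  qed
  show "charge_field h a b (field_force \<phi>)"
  proof
    show "field_force \<phi> y < field_force \<phi> x"
      if "x \<in> einterval a b" "y \<in> einterval a b" "x < y" for x y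
      using strict [OF that] pos [OF that(1)] pos [OF that(2)] assms(1)
      by (simp add: force that(1,2) divide_strict_right_mono)
    have "continuous_on (einterval a b) (\<lambda>x. 1 / (2 * h) * ln (f x))"
      unfolding f_def using pos by (intro continuous_intros) (auto simp: f_def dest: less_imp_neq [THEN not_sym])
    then show "continuous_on (einterval a b) (field_force \<phi>)"
      by (rule continuous_on_eq) (simp add: force)
    show "\<exists>x\<in>einterval a b. 0 < field_force \<phi> x"
      using gt1 assms(1) by (auto simp: force intro!: bexI)
    show "\<exists>x\<in>einterval a b. field_force \<phi> x < 0"
      using lt1 assms(1) pos by (auto simp: force divide_neg_pos intro!: bexI)
    show "\<exists>x\<in>einterval a b. K < field_force \<phi> x" if finite: "a \<noteq> - \<infinity>" for K
    proof -
      obtain x where x: "x \<in> einterval a b" "exp (2 * h * K) < f x" using above [OF finite] by blast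
      then have "ln (exp (2 * h * K)) < ln (f x)" using pos by (subst ln_less_cancel_iff) auto
      then have "2 * h * K < ln (f x)" by simp
      then show ?thesis
        using x(1) assms(1) by (intro bexI [of _ x]) (auto simp: force pos_less_divide_eq mult.commute)
    qed
    show "\<exists>x\<in>einterval a b. field_force \<phi> x < K" if finite: "b \<noteq> \<infinity>" for K
    proof -
      obtain x where x: "x \<in> einterval a b" "f x < exp (2 * h * K)"
        using below [OF finite exp_gt_zero] by blast
      then have "ln (f x) < ln (exp (2 * h * K))" using pos by (subst ln_less_cancel_iff) auto
      then have "ln (f x) < 2 * h * K" by simp
      then show ?thesis
        using x(1) assms(1) by (intro bexI [of _ x]) (auto simp: force pos_divide_less_eq mult.commute)
    qed
  qed (rule assms(1))
qed

theorem theorem2p8: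
  fixes h :: real and a b :: ereal and A B :: "real poly" and \<phi> :: "real \<Rightarrow> real" and n :: nat
  assumes "h > 0" and "a < b"
    and "G_convex h a b A B \<phi>"
    and "n \<ge> 1"
    and "\<And>a' b'. a = ereal a' \<Longrightarrow> b = ereal b' \<Longrightarrow> int n \<le> \<lceil>(b' - a') / h\<rceil>"
  shows "\<exists>x. critical_distribution h a b \<phi> n x \<and>
           (\<forall>y. critical_distribution h a b \<phi> n y \<longrightarrow> (\<forall>j\<in>{1..n}. y j = x j)) \<and>
           equilibrium_distribution h a b \<phi> n x \<and>
           (\<forall>x0. admissible h a b n x0 \<longrightarrow>
              (\<exists>X. iedm_iterates h a b \<phi> n x0 X) \<and>
              (\<forall>X. iedm_iterates h a b \<phi> n x0 X \<longrightarrow>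
                 (\<forall>j\<in>{1..n}. (\<lambda>l. X l j) \<longlonglongrightarrow> x j)))"
proof -
  interpret charge_field h a b "field_force \<phi>" n
    using assms by (intro G_convex_charge_field)
  have deriv: "(\<phi> has_real_derivative - field_force \<phi> x) (at x)" if "x \<in> I" for x
    using G_convex_charge_field(2) assms(1-3) that by blast
  have crit: "critical_distribution h a b \<phi> n x \<longleftrightarrow> adm x \<and> super x \<and> sub x" for x
    unfolding critical_distribution_def super_def sub_def net_force_def by force
  have "(real n - 1) * h < b' - a'" if "a = ereal a'" "b = ereal b'" for a' b'
  proof -
    \<comment> \<open>\<open>n \<le> \<lceil>t\<rceil>\<close> amounts to \<open>n - 1 < t\<close>:
      room for \<open>n\<close> charges with gaps above \<open>h\<close> in an open
      interval.\<close>
    have "real n - 1 < (b' - a') / h" using assms(5) [OF that] by linarith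
    then show ?thesis using assms(1) by (simp add: pos_less_divide_eq)
  qed
  then obtain x0 where x0: "adm x0" using admissible_exists by blast
  obtain w where w: "adm w" "super w" "sub w"
    and conv: "\<And>X j. \<lbrakk>adm (X 0); \<And>l. sweep (X l) (X (Suc l)); j \<in> {1..n}\<rbrakk> \<Longrightarrow> (\<lambda>l. X l j) \<longlonglongrightarrow> w j"
    using sweep_convergence [OF x0] by auto
  have "y j = w j" if "critical_distribution h a b \<phi> n y" "j \<in> {1..n}" for y j
    using that sub_le_super w unfolding crit by (intro antisym) auto
  moreover have "equilibrium_distribution h a b \<phi> n w"
    unfolding equilibrium_distribution_def
  proof (intro conjI ballI allI impI)
    show "a \<le> ereal (w j)" "ereal (w j) \<le> b" if "j \<in> {1..n}" for j
      using admD(1) [OF w(1) that] by (auto simp: einterval_iff)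
    show "separated h n w" using w(1) by (simp add: admissible_def)
    fix y
    assume y: "(\<forall>j\<in>{1..n}. y j \<in> I) \<and> (\<forall>j\<in>{1..n}. \<forall>k\<in>{1..n}. j \<noteq> k \<longrightarrow> h < \<bar>y j - y k\<bar>)"
    \<comment> \<open>Competitors come in any order; the convexity argument compares distributions
      in increasing order only.\<close>
    obtain z where z: "adm z" "energy h \<phi> n z = energy h \<phi> n y"
      by (rule sorted_rearrangement [of h n y a b \<phi>]) (use y h_pos in auto)
    have "energy h \<phi> n w \<le> energy h \<phi> n z"
      using subD [OF w(3)] superD [OF w(2)] by (intro critical_energy_le deriv w z antisym)
    then show "energy h \<phi> n w \<le> energy h \<phi> n y" using z(2) by simp
  qed
  moreover have "\<exists>X. iedm_iterates h a b \<phi> n x0 X" if "adm x0" for x0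
    using sweep_sequence_exists [OF that] sweep_iedm_iterates [OF refl] by metis
  moreover have "(\<lambda>l. X l j) \<longlonglongrightarrow> w j"
    if "adm x0" "iedm_iterates h a b \<phi> n x0 X" "j \<in> {1..n}" for x0 X j
    using iedm_iterates_sweep [OF refl that(1,2)] by (intro conv that(3))
  ultimately show ?thesis
    using w crit by (intro exI [of _ w]) blast
qed

end
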